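(* Let $A$, $P$, $L$ be as in the context, let $A_{|(1-P)\mathfrak H}$ be the closure of $(1-P)A(1-P)$ on $LD(L)$, and assume $d:=\sup\sigma(A_{|(1-P)\mathfrak H})<\infty$. (i) Let $m_2''=\inf_{x\in D(L)\setminus\{0\}}\mu_2(x)$ and assume $m_2''>d$. Then $\mathrm{Spu}(A,P,L)\cap(d,m_2'')=\emptyset$. (ii) Let $m_2'=\inf\liminf_{n\to\infty}\mu_2(x_n)$, the infimum being over all sequences $\{x_n\}\subset D(L)\setminus\{0\}$ with $\|x_n\|=1$ and $x_n\rightharpoonup0$ weakly, and assume $m_2'>d$. Assume moreover that for some real $b>d$ (or $b=+\infty$) the following holds: whenever $\{x_n\}\subset D(L)$, $x_n\to0$ strongly and $\limsup_n\mu_2(x_n)<b$, then $\langle Ax_n,x_n\rangle\to0$. Then $\mathrm{Spu}(A,P,L)\cap\big(d,\min(m_2',b)\big)=\emptyset$.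
   Context: $A$ is a self-adjoint operator on a separable Hilbert space $\mathfrak H$ with dense domain $D(A)$ (graph norm $\|x\|^2+\|Ax\|^2$), $P$ an orthogonal projector on $\mathfrak H$, and $L:D(L)\subset P\mathfrak H\to(1-P)\mathfrak H$ an injective linear operator such that $D(L)\oplus LD(L)\subset D(A)$ is a core for $A$. It is assumed that $PAP$ is essentially self-adjoint on $D(L)$ and $(1-P)A(1-P)$ is essentially self-adjoint on $LD(L)$. For a finite-dimensional $V\subset D(A)$, $A_{|V}$ is the restriction of $P_VAP_V$ to $V$. For $0\ne x\in D(L)$, $\mu_1(x)\le\mu_2(x)$ are the two eigenvalues of $A_{|\mathrm{span}\{x,Lx\}}$ (the $2\times2$ matrix of $A$ on $x\mathbb C\oplus Lx\,\mathbb C$). $\lambda\in\mathbb R$ is a $(P,L)$-spurious eigenvalue, $\lambda\in\mathrm{Spu}(A,P,L)$, if there exist finite-dimensional subspaces $V_n^+\subset D(L)$, $V_n^+\subset V_{n+1}^+$, such that $\bigcup_n(V_n^+\oplus LV_n^+)$ is dense in $D(A)$ for the graph norm, $\lim_n\mathrm{dist}(\lambda,\sigma(A_{|V_n^+\oplus LV_n^+}))=0$, and $\lambda\notin\sigma(A)$. *)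

theory Defs
  imports "HOL-Analysis.Analysis"
begin

text \<open>A complex Hilbert space is modelled as a real Hilbert space of type 'h
  (class real_inner + complete_space) together with a complex structure J
  (multiplication by the imaginary unit): J is real-linear, J (J x) = - x and
  J is orthogonal.  The complex inner product is inner x y + i inner x (J y);
  its real part is the real inner product.  Complex subspaces are J-invariant
  real subspaces, complex-linear maps are real-linear maps commuting with J.\<close>

definition cstruct :: "('h::real_inner \<Rightarrow> 'h) \<Rightarrow> bool" where
  "cstruct J \<longleftrightarrow> linear J \<and> (\<forall>x. J (J x) = - x) \<and> (\<forall>x y. inner (J x) (J y) = inner x y)"

definition csubspace :: "('h::real_inner \<Rightarrow> 'h) \<Rightarrow> 'h set \<Rightarrow> bool" where
  "csubspace J S \<longleftrightarrow> subspace S \<and> (\<forall>x\<in>S. J x \<in> S)"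

definition clinear_on :: "('h::real_inner \<Rightarrow> 'h) \<Rightarrow> 'h set \<Rightarrow> ('h \<Rightarrow> 'h) \<Rightarrow> bool" where
  "clinear_on J D T \<longleftrightarrow> csubspace J D \<and>
     (\<forall>x\<in>D. \<forall>y\<in>D. T (x + y) = T x + T y) \<and>
     (\<forall>x\<in>D. \<forall>c. T (c *\<^sub>R x) = c *\<^sub>R T x) \<and>
     (\<forall>x\<in>D. T (J x) = J (T x))"

definition adj_dom :: "'h set \<Rightarrow> 'h set \<Rightarrow> ('h::real_inner \<Rightarrow> 'h) \<Rightarrow> 'h set" where
  "adj_dom K D T = {y\<in>K. \<exists>z\<in>K. \<forall>x\<in>D. inner (T x) y = inner x z}"

definition self_adjoint_in ::
  "('h::real_inner \<Rightarrow> 'h) \<Rightarrow> 'h set \<Rightarrow> 'h set \<Rightarrow> ('h \<Rightarrow> 'h) \<Rightarrow> bool" where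
  "self_adjoint_in J K D T \<longleftrightarrow> clinear_on J D T \<and> D \<subseteq> K \<and> K \<subseteq> closure D \<and>
     (\<forall>x\<in>D. T x \<in> K) \<and>
     (\<forall>x\<in>D. \<forall>y\<in>D. inner (T x) y = inner x (T y)) \<and>
     adj_dom K D T \<subseteq> D"

definition gclos_dom :: "'h set \<Rightarrow> ('h::real_normed_vector \<Rightarrow> 'h) \<Rightarrow> 'h set" where
  "gclos_dom S T = {x. \<exists>s. (\<forall>n. s n \<in> S) \<and> s \<longlonglongrightarrow> x \<and> convergent (\<lambda>n. T (s n))}"

definition gclos :: "'h set \<Rightarrow> ('h::real_normed_vector \<Rightarrow> 'h) \<Rightarrow> 'h \<Rightarrow> 'h" where
  "gclos S T x = lim (\<lambda>n. T ((SOME s. (\<forall>n. s n \<in> S) \<and> s \<longlonglongrightarrow> x \<and> convergent (\<lambda>n. T (s n))) n))"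

definition closable :: "'h set \<Rightarrow> ('h::real_normed_vector \<Rightarrow> 'h) \<Rightarrow> bool" where
  "closable S T \<longleftrightarrow> (\<forall>s. (\<forall>n. s n \<in> S) \<and> s \<longlonglongrightarrow> 0 \<and> convergent (\<lambda>n. T (s n))
        \<longrightarrow> lim (\<lambda>n. T (s n)) = 0)"

definition ess_self_adjoint_in ::
  "('h::{real_inner,complete_space} \<Rightarrow> 'h) \<Rightarrow> 'h set \<Rightarrow> 'h set \<Rightarrow> ('h \<Rightarrow> 'h) \<Rightarrow> bool" where
  "ess_self_adjoint_in J K S T \<longleftrightarrow> closable S T \<and> self_adjoint_in J K (gclos_dom S T) (gclos S T)"

text \<open>Real spectrum of T (domain D) in the Hilbert space K: the real \<lambda> for which
  T - \<lambda> is not a bijection D \<rightarrow> K with bounded inverse.  (Self-adjoint operators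
  have real spectrum.)\<close>
definition spec_in :: "'h set \<Rightarrow> 'h set \<Rightarrow> ('h::real_normed_vector \<Rightarrow> 'h) \<Rightarrow> real set" where
  "spec_in K D T = {l. \<not> (bij_betw (\<lambda>x. T x - l *\<^sub>R x) D K \<and>
                          (\<exists>C. \<forall>x\<in>D. norm x \<le> C * norm (T x - l *\<^sub>R x)))}"

definition graph_dense :: "'h set \<Rightarrow> ('h::real_normed_vector \<Rightarrow> 'h) \<Rightarrow> 'h set \<Rightarrow> bool" where
  "graph_dense D T S \<longleftrightarrow> (\<forall>x\<in>D. \<forall>e>0. \<exists>y\<in>S.
       sqrt ((norm (x - y))\<^sup>2 + (norm (T x - T y))\<^sup>2) < e)"

definition is_core :: "'h set \<Rightarrow> ('h::real_normed_vector \<Rightarrow> 'h) \<Rightarrow> 'h set \<Rightarrow> bool" where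
  "is_core D T S \<longleftrightarrow> subspace S \<and> S \<subseteq> D \<and> graph_dense D T S"

definition findim :: "'h::real_vector set \<Rightarrow> bool" where
  "findim V \<longleftrightarrow> (\<exists>B. finite B \<and> V = span B)"

definition oproj :: "'h set \<Rightarrow> 'h \<Rightarrow> 'h::real_inner" where
  "oproj V x = (THE p. p \<in> V \<and> (\<forall>w\<in>V. inner (x - p) w = 0))"

text \<open>Spectrum of A_{|V} = P_V A P_V restricted to V (V finite-dimensional).\<close>
definition compr_spec :: "('h::real_inner \<Rightarrow> 'h) \<Rightarrow> 'h set \<Rightarrow> real set" where
  "compr_spec A V = {l. \<exists>v\<in>V. v \<noteq> 0 \<and> oproj V (A v) = l *\<^sub>R v}"

definition dsum :: "'h set \<Rightarrow> ('h::real_vector \<Rightarrow> 'h) \<Rightarrow> 'h set" where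
  "dsum V L = {v + L w | v w. v \<in> V \<and> w \<in> V}"

definition cspan2 :: "('h::real_vector \<Rightarrow> 'h) \<Rightarrow> 'h \<Rightarrow> 'h \<Rightarrow> 'h set" where
  "cspan2 J x y = span {x, J x, y, J y}"

definition mu2 :: "('h::real_inner \<Rightarrow> 'h) \<Rightarrow> ('h \<Rightarrow> 'h) \<Rightarrow> ('h \<Rightarrow> 'h) \<Rightarrow> 'h \<Rightarrow> real" where
  "mu2 J A L x = Max (compr_spec A (cspan2 J x (L x)))"

definition Spu :: "('h::{real_inner,complete_space} \<Rightarrow> 'h) \<Rightarrow> 'h set \<Rightarrow> ('h \<Rightarrow> 'h)
     \<Rightarrow> 'h set \<Rightarrow> ('h \<Rightarrow> 'h) \<Rightarrow> real set" where
  "Spu J DA A DL L = {l. (\<exists>V::nat \<Rightarrow> 'h set.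
       (\<forall>n. csubspace J (V n) \<and> findim (V n) \<and> V n \<subseteq> DL) \<and>
       (\<forall>n. V n \<subseteq> V (Suc n)) \<and>
       graph_dense DA A (\<Union>n. dsum (V n) L) \<and>
       (\<lambda>n. infdist l (compr_spec A (dsum (V n) L))) \<longlonglongrightarrow> 0)
     \<and> l \<notin> spec_in UNIV DA A}"

definition weak_to_zero :: "(nat \<Rightarrow> 'h::real_inner) \<Rightarrow> bool" where
  "weak_to_zero x \<longleftrightarrow> (\<forall>y. (\<lambda>n. inner (x n) y) \<longlonglongrightarrow> 0)"

end

theory Submission
  imports Defs
begin

text \<open>Let \<open>u = p + L q\<close> be an eigenvector of \<open>A\<close> compressed to \<open>V \<oplus> L V\<close>, with
  eigenvalue \<open>l > d\<close>. The form of \<open>A - l\<close> is negative on \<open>L V\<close>, so \<open>u\<close> maximises it on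
  \<open>u + L V\<close>, with value 0; this forces \<open>p \<noteq> 0\<close> and \<open>\<mu>\<^sub>2(p) \<le> l\<close>, which gives (i). For (ii),
  normalised eigenvectors \<open>u\<^sub>n = p\<^sub>n + L q\<^sub>n\<close> with eigenvalues \<open>l\<^sub>n\<close> tending to a spurious \<open>l\<close> go
  weakly to 0, since \<open>A - l\<close> is onto. If \<open>p\<^sub>n\<close> did not go to 0 strongly, normalising it along a
  subsequence would contradict \<open>l < m\<^sub>2'\<close>. So \<open>p\<^sub>n \<rightarrow> 0\<close>, hence \<open>\<langle>A p\<^sub>n, p\<^sub>n\<rangle> \<rightarrow> 0\<close>; but
  \<open>\<langle>(A - l\<^sub>n) p\<^sub>n, p\<^sub>n\<rangle> = \<langle>(A - l\<^sub>n) L q\<^sub>n, L q\<^sub>n\<rangle> \<le> (d - l\<^sub>n) \<parallel>L q\<^sub>n\<parallel>\<^sup>2 \<rightarrow> d - l < 0\<close>.\<close>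

subsection \<open>Symmetric operators compressed to finite-dimensional subspaces\<close>

text \<open>Gram-Schmidt gives a finite orthogonal spanning set; 0 is removed before normalising.
  The basis is real: complex subspaces are treated as real ones here.\<close>

lemma findim_orthonormal_basis:
  fixes V :: "'h::real_inner set"
  assumes "findim V"
  obtains B where "finite B" "\<And>b. b \<in> B \<Longrightarrow> norm b = 1" "pairwise orthogonal B" "span B = V"
proof -
  obtain B0 where B0: "finite B0" "V = span B0" using assms by (auto simp: findim_def)
  obtain C where C: "finite C" "span C = V" "pairwise orthogonal C"
    using basis_orthogonal[OF B0(1)] B0(2) by auto
  let ?B = "(\<lambda>x. x /\<^sub>R norm x) ` (C - {0})"
  show thesis
  proof (rule that[of ?B])
    show "finite ?B" using C by simp
    show "norm b = 1" if "b \<in> ?B" for b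
    proof -
      obtain x where "x \<noteq> 0" "b = x /\<^sub>R norm x" using \<open>b \<in> ?B\<close> by auto
      then show ?thesis by simp
    qed
    show "pairwise orthogonal ?B"
      using C(3) by (auto simp: pairwise_def orthogonal_def)
    have "span ?B = span (C - {0})"
      by (rule span_image_scale) (use C in auto)
    then show "span ?B = V" using C(2) span_delete_0 by metis
  qed
qed

text \<open>In an arbitrary normed space compactness is built one vector at a time: each set is the
  continuous image of an interval times the previous set.\<close>

lemma compact_bounded_combinations:
  fixes B :: "'h::real_normed_vector set"
  assumes "finite B"
  shows "compact {\<Sum>b\<in>B. c b *\<^sub>R b | c. \<forall>b\<in>B. \<bar>c b\<bar> \<le> (1::real)}"
  using assms
proof (induction B rule: finite_induct)
  case empty
  then show ?case by simp
next
  case (insert a B)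
  let ?K = "{\<Sum>b\<in>B. c b *\<^sub>R b | c. \<forall>b\<in>B. \<bar>c b\<bar> \<le> (1::real)}"
  have "compact ((\<lambda>(t, y). t *\<^sub>R a + y) ` ({-1..1} \<times> ?K))"
    by (intro compact_continuous_image compact_Times insert.IH compact_Icc)
       (auto simp: case_prod_unfold intro!: continuous_intros)
  moreover have "(\<lambda>(t, y). t *\<^sub>R a + y) ` ({-1..1} \<times> ?K) =
      {\<Sum>b\<in>insert a B. c b *\<^sub>R b | c. \<forall>b\<in>insert a B. \<bar>c b\<bar> \<le> (1::real)}" (is "?L = ?R")
  proof
    show "?L \<subseteq> ?R"
    proof clarsimp
      fix t :: real and c :: "'h \<Rightarrow> real" assume t: "-1 \<le> t" "t \<le> 1" and c: "\<forall>b\<in>B. \<bar>c b\<bar> \<le> 1"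
      have "(\<Sum>b\<in>B. c b *\<^sub>R b) = (\<Sum>b\<in>B. (c(a := t)) b *\<^sub>R b)"
        using insert.hyps by (intro sum.cong) auto
      then show "\<exists>c'. t *\<^sub>R a + (\<Sum>b\<in>B. c b *\<^sub>R b) = (\<Sum>b\<in>insert a B. c' b *\<^sub>R b) \<and>
          \<bar>c' a\<bar> \<le> 1 \<and> (\<forall>b\<in>B. \<bar>c' b\<bar> \<le> 1)"
        using insert.hyps t c by (intro exI[of _ "c(a := t)"]) auto
    qed
    show "?R \<subseteq> ?L"
    proof clarify
      fix c :: "'h \<Rightarrow> real" assume c: "\<forall>b\<in>insert a B. \<bar>c b\<bar> \<le> (1::real)"
      have "(\<Sum>b\<in>insert a B. c b *\<^sub>R b) = (\<lambda>(t, y). t *\<^sub>R a + y) (c a, \<Sum>b\<in>B. c b *\<^sub>R b)"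
        using insert.hyps by simp
      moreover have "(c a, \<Sum>b\<in>B. c b *\<^sub>R b) \<in> {-1..1} \<times> ?K" using c by auto
      ultimately show "(\<Sum>b\<in>insert a B. c b *\<^sub>R b) \<in> ?L" by (rule image_eqI)
    qed
  qed
  ultimately show ?case by simp
qed

lemma findim_subspace: "findim V \<Longrightarrow> subspace V"
  by (auto simp: findim_def)

text \<open>By Cauchy-Schwarz the coordinates of a unit vector in an orthonormal basis are at most 1
  in modulus, so the sphere is a closed part of a compact set of combinations.\<close>

lemma compact_findim_sphere:
  fixes V :: "'h::real_inner set"
  assumes "findim V"
  shows "compact (V \<inter> sphere 0 1)"
proof -
  obtain B where B: "finite B" "\<And>b. b \<in> B \<Longrightarrow> norm b = 1" "pairwise orthogonal B" "span B = V"
    using findim_orthonormal_basis[OF assms] by metis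
  let ?K = "{\<Sum>b\<in>B. c b *\<^sub>R b | c. \<forall>b\<in>B. \<bar>c b\<bar> \<le> 1}"
  have "?K \<subseteq> V" unfolding B(4)[symmetric] by (auto intro: span_sum span_scale span_base)
  moreover have "x \<in> ?K" if "x \<in> V" "norm x = 1" for x
  proof -
    have "x = (\<Sum>b\<in>B. (x \<bullet> b) *\<^sub>R b)"
      using orthonormal_basis_expand[OF B(3,2) _ B(1)] B(4) that(1) by simp
    moreover have "\<forall>b\<in>B. \<bar>x \<bullet> b\<bar> \<le> 1"
    proof
      fix b assume "b \<in> B"
      then show "\<bar>x \<bullet> b\<bar> \<le> 1" using Cauchy_Schwarz_ineq2[of x b] that B(2) by simp
    qed
    ultimately show ?thesis by blast
  qed
  ultimately have "V \<inter> {x. norm x = 1} = ?K \<inter> {x. norm x = 1}" by blast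
  moreover have "closed {x::'h. norm x = 1}"
    by (intro closed_Collect_eq continuous_intros)
  then have "compact (?K \<inter> {x. norm x = 1})"
    by (rule compact_Int_closed[OF compact_bounded_combinations[OF B(1)]])
  ultimately show ?thesis by (simp add: sphere_def)
qed

text \<open>Orthogonal expansion gives existence and definiteness gives uniqueness, so the
  description in \<open>oproj\<close> really denotes the orthogonal projection.\<close>

lemma oproj_findim:
  fixes V :: "'h::real_inner set"
  assumes "findim V"
  shows "oproj V x \<in> V" and "\<And>w. w \<in> V \<Longrightarrow> inner (x - oproj V x) w = 0"
    and "\<And>p. p \<in> V \<Longrightarrow> (\<And>w. w \<in> V \<Longrightarrow> inner (x - p) w = 0) \<Longrightarrow> oproj V x = p"
proof -
  obtain B where B: "finite B" "\<And>b. b \<in> B \<Longrightarrow> norm b = 1" "pairwise orthogonal B" "span B = V"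
    using findim_orthonormal_basis[OF assms] by metis
  have sV: "subspace V" using assms by (rule findim_subspace)
  let ?p = "\<Sum>b\<in>B. (x \<bullet> b) *\<^sub>R b"
  have pV: "?p \<in> V" unfolding B(4)[symmetric] by (intro span_sum span_scale span_base)
  have p0: "inner (x - ?p) w = 0" if "w \<in> V" for w
  proof -
    have "orthogonal (x - ?p) b" if b: "b \<in> B" for b
    proof -
      have "?p \<bullet> b = (\<Sum>c\<in>B. (x \<bullet> c) * (c \<bullet> b))" by (simp add: inner_sum_left)
      also have "\<dots> = (\<Sum>c\<in>B. if c = b then x \<bullet> b else 0)"
        using B(2,3) b by (intro sum.cong) (auto simp: pairwise_def orthogonal_def dot_square_norm)
      also have "\<dots> = x \<bullet> b" using B(1) b by simp
      finally show ?thesis by (simp add: orthogonal_def inner_diff_left)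
    qed
    then show ?thesis
      using orthogonal_to_span[of w B "x - ?p"] that B(4) by (auto simp: orthogonal_def)
  qed
  have uniq: "q = p" if "p \<in> V" "\<forall>w\<in>V. inner (x - p) w = 0" "q \<in> V" "\<forall>w\<in>V. inner (x - q) w = 0" for p q
  proof -
    have "q - p \<in> V" using that sV by (simp add: subspace_diff)
    with that have "inner (x - p) (q - p) - inner (x - q) (q - p) = 0" by simp
    then have "inner (q - p) (q - p) = 0" by (simp add: inner_diff_left)
    then show ?thesis by simp
  qed
  have "oproj V x \<in> V \<and> (\<forall>w\<in>V. inner (x - oproj V x) w = 0)"
    unfolding oproj_def by (rule theI[where a = ?p]) (use pV p0 uniq in blast)+
  then show "oproj V x \<in> V" and "\<And>w. w \<in> V \<Longrightarrow> inner (x - oproj V x) w = 0"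
    and "\<And>p. p \<in> V \<Longrightarrow> (\<And>w. w \<in> V \<Longrightarrow> inner (x - p) w = 0) \<Longrightarrow> oproj V x = p"
    using uniq by blast+
qed

text \<open>The weak form of the eigenvalue equation trades the projection for testing against all
  of \<open>V\<close>; compressed eigenvectors are used only in this form below.\<close>

lemma compr_spec_iff:
  fixes V :: "'h::real_inner set"
  assumes "findim V"
  shows "l \<in> compr_spec A V \<longleftrightarrow> (\<exists>v\<in>V. v \<noteq> 0 \<and> (\<forall>w\<in>V. inner (A v - l *\<^sub>R v) w = 0))"
proof -
  have "oproj V (A v) = l *\<^sub>R v \<longleftrightarrow> (\<forall>w\<in>V. inner (A v - l *\<^sub>R v) w = 0)" if "v \<in> V" for v
  proof -
    have "l *\<^sub>R v \<in> V" using that findim_subspace[OF assms] by (simp add: subspace_scale)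
    then show ?thesis
      using oproj_findim(2)[OF assms, of _ "A v"] oproj_findim(3)[OF assms, of "l *\<^sub>R v" "A v"] by auto
  qed
  then show ?thesis by (auto simp: compr_spec_def)
qed

text \<open>Eigenvectors for distinct eigenvalues are orthogonal, hence independent, so a finite
  spanning set bounds their number. Finiteness makes \<open>Max\<close> in \<open>mu2\<close>
  meaningful and lets \<open>infdist\<close> be attained.\<close>

lemma finite_compr_spec:
  fixes V :: "'h::real_inner set"
  assumes fin: "findim V"
    and sym: "\<And>x y. x \<in> V \<Longrightarrow> y \<in> V \<Longrightarrow> inner (A x) y = inner x (A y)"
  shows "finite (compr_spec A V)"
proof -
  obtain B where B: "finite B" "V = span B" using fin by (auto simp: findim_def)
  have "\<forall>l\<in>compr_spec A V. \<exists>v. v \<in> V \<and> v \<noteq> 0 \<and> (\<forall>w\<in>V. inner (A v - l *\<^sub>R v) w = 0)"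
    using compr_spec_iff[OF fin] by blast
  then obtain f where f: "\<And>l. l \<in> compr_spec A V \<Longrightarrow> f l \<in> V" "\<And>l. l \<in> compr_spec A V \<Longrightarrow> f l \<noteq> 0"
      "\<And>l w. l \<in> compr_spec A V \<Longrightarrow> w \<in> V \<Longrightarrow> inner (A (f l) - l *\<^sub>R f l) w = 0"
    by metis
  have orth: "inner (f l) (f m) = 0" if "l \<in> compr_spec A V" "m \<in> compr_spec A V" "l \<noteq> m" for l m
  proof -
    have "inner (A (f l) - l *\<^sub>R f l) (f m) = 0" "inner (A (f m) - m *\<^sub>R f m) (f l) = 0"
      using f that by blast+
    moreover have "inner (A (f l)) (f m) = inner (A (f m)) (f l)"
      using sym f that by (metis inner_commute)
    ultimately have "(l - m) * inner (f l) (f m) = 0"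
      by (simp add: inner_diff_left inner_commute algebra_simps)
    then show ?thesis using that by simp
  qed
  have inj: "inj_on f (compr_spec A V)"
    using orth f(2) by (intro inj_onI) (metis inner_eq_zero_iff)
  have "independent (f ` compr_spec A V)"
    using orth f(2) by (intro pairwise_orthogonal_independent) (auto simp: pairwise_def orthogonal_def)
  then have "finite (f ` compr_spec A V)"
    using independent_span_bound[OF B(1)] f(1) B(2) by blast
  then show ?thesis using inj finite_image_iff by blast
qed

text \<open>The maximum of the Rayleigh quotient over the (compact) unit sphere is an eigenvalue.\<close>
lemma compr_spec_nonempty:
  fixes V :: "'h::real_inner set"
  assumes fin: "findim V" and ne: "v \<in> V" "v \<noteq> 0"
    and add: "\<And>x y. x \<in> V \<Longrightarrow> y \<in> V \<Longrightarrow> A (x + y) = A x + A y"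
    and scale: "\<And>c x. x \<in> V \<Longrightarrow> A (c *\<^sub>R x) = c *\<^sub>R A x"
    and sym: "\<And>x y. x \<in> V \<Longrightarrow> y \<in> V \<Longrightarrow> inner (A x) y = inner x (A y)"
  shows "compr_spec A V \<noteq> {}"
proof -
  obtain B where B: "finite B" "\<And>b. b \<in> B \<Longrightarrow> norm b = 1" "pairwise orthogonal B" "span B = V"
    using findim_orthonormal_basis[OF fin] by metis
  have sV: "subspace V" using fin by (rule findim_subspace)
  have A0: "A 0 = 0" using scale[OF ne(1), of 0] by simp
  \<comment> \<open>Expanding in the basis shows that \<open>A\<close>, known only to be linear on
    \<open>V\<close>, is continuous there.\<close>
  have A_sum: "F \<subseteq> B \<Longrightarrow> A (\<Sum>b\<in>F. c b *\<^sub>R b) = (\<Sum>b\<in>F. c b *\<^sub>R A b)" if "finite F" for c F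
    using that
  proof (induction F rule: finite_induct)
    case empty then show ?case by (simp add: A0)
  next
    case (insert b F)
    have "b \<in> V" "(\<Sum>b\<in>F. c b *\<^sub>R b) \<in> V" 
      using insert.prems unfolding B(4)[symmetric] by (auto intro!: span_sum span_scale intro: span_base)
    then show ?case using insert add scale sV by (simp add: subspace_scale)
  qed
  have A_exp: "A x = (\<Sum>b\<in>B. (x \<bullet> b) *\<^sub>R A b)" if "x \<in> V" for x
    using orthonormal_basis_expand[OF B(3,2) _ B(1), of x] B(4) that A_sum[OF B(1), of "\<lambda>b. x \<bullet> b"]
    by simp
  have "continuous_on (V \<inter> sphere 0 1) (\<lambda>x. (\<Sum>b\<in>B. (x \<bullet> b) *\<^sub>R A b) \<bullet> x)"
    by (intro continuous_intros)
  then have cont: "continuous_on (V \<inter> sphere 0 1) (\<lambda>x. A x \<bullet> x)"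
    by (rule continuous_on_eq) (use A_exp in auto)
  have "v /\<^sub>R norm v \<in> V \<inter> sphere 0 1"
    using ne sV by (auto simp: subspace_scale)
  then obtain u where u: "u \<in> V \<inter> sphere 0 1" 
      and umax: "\<And>y. y \<in> V \<inter> sphere 0 1 \<Longrightarrow> A y \<bullet> y \<le> A u \<bullet> u"
    using continuous_attains_sup[OF compact_findim_sphere[OF fin] _ cont] by blast
  define l where "l = A u \<bullet> u"
  have le: "A y \<bullet> y \<le> l * (y \<bullet> y)" if "y \<in> V" for y
  proof (cases "y = 0")
    case False
    have "y /\<^sub>R norm y \<in> V \<inter> sphere 0 1" using False that sV by (auto simp: subspace_scale)
    from umax[OF this] have "(A y \<bullet> y) / (norm y)\<^sup>2 \<le> l"
      using that by (simp add: scale l_def power2_eq_square divide_simps)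
    then show ?thesis using False by (simp add: divide_simps dot_square_norm mult.commute)
  qed (simp add: A0)
  have uu: "u \<bullet> u = 1" using u by (simp add: dot_square_norm)
  have "inner (A u - l *\<^sub>R u) w = 0" if w: "w \<in> V" for w
  proof -
    define g where "g = inner (A u - l *\<^sub>R u) w"
    define h where "h = A w \<bullet> w - l * (w \<bullet> w)"
    \<comment> \<open>First variation at the maximiser \<open>u\<close> in direction
      \<open>w\<close>: the terms without \<open>t\<close> cancel because \<open>u\<close> is a unit
      vector with Rayleigh quotient \<open>l\<close>.\<close>
    have key: "2 * t * g + t\<^sup>2 * h \<le> 0" for t
    proof -
      have tw: "t *\<^sub>R w \<in> V" "u \<in> V" using w sV u by (auto simp: subspace_scale)
      have "A (u + t *\<^sub>R w) \<bullet> (u + t *\<^sub>R w) \<le> l * ((u + t *\<^sub>R w) \<bullet> (u + t *\<^sub>R w))"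
        using tw sV by (intro le) (simp add: subspace_add)
      moreover have "A w \<bullet> u = A u \<bullet> w" using sym[OF w, of u] tw by (simp add: inner_commute)
      moreover have "w \<bullet> u = u \<bullet> w" by (simp add: inner_commute)
      ultimately show ?thesis
        using uu by (simp add: add tw scale w inner_add_left inner_add_right g_def h_def l_def
            inner_diff_left power2_eq_square algebra_simps)
    qed
    have "g = 0"
    proof (rule ccontr)
      assume g: "g \<noteq> 0"
      \<comment> \<open>At \<open>t = s * g\<close> the left side of \<open>key\<close> is
        \<open>s * g\<^sup>2 * (2 + s * h)\<close>; this \<open>s\<close> keeps \<open>s * h\<close>
        above -1, so the value is positive.\<close>
      define s where "s = 1 / (\<bar>h\<bar> + 1)"
      have s: "s > 0" "s * \<bar>h\<bar> < 1" by (auto simp: s_def divide_simps)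
      have "2 * (s * g) * g + (s * g)\<^sup>2 * h = s * g\<^sup>2 * (2 + s * h)"
        by (simp add: power2_eq_square algebra_simps)
      moreover have "\<bar>s * h\<bar> = s * \<bar>h\<bar>" using s(1) by (simp add: abs_mult)
      then have "2 + s * h > 0" using s(2) by linarith
      ultimately show False using key[of "s * g"] s g
        by (metis mult_pos_pos not_less zero_less_power2)
    qed
    then show ?thesis by (simp add: g_def)
  qed
  moreover have "u \<noteq> 0" "u \<in> V" using u by auto
  ultimately show ?thesis using compr_spec_iff[OF fin, of l A] by blast
qed

subsection \<open>The form of a self-adjoint operator is bounded by its spectrum\<close>

text \<open>\<open>gclos\<close> evaluates along an arbitrarily chosen sequence. That sequence minus
  \<open>x\<close> tends to 0, and closability then forces the limit of its images to be 0.\<close>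

lemma gclos_extends:
  assumes clos: "closable S T" and S: "subspace S" and x: "x \<in> S"
    and diff: "\<And>y. y \<in> S \<Longrightarrow> T (y - x) = T y - T x"
  shows "x \<in> gclos_dom S T" and "gclos S T x = T x"
proof -
  let ?P = "\<lambda>s. (\<forall>n. s n \<in> S) \<and> s \<longlonglongrightarrow> x \<and> convergent (\<lambda>n. T (s n))"
  have c: "?P (\<lambda>n. x)" using x by (auto intro: convergent_const)
  then show "x \<in> gclos_dom S T" unfolding gclos_dom_def by (intro CollectI exI)
  define s where "s = (SOME s. ?P s)"
  have s: "?P s" unfolding s_def using someI[of ?P, OF c] .
  have eq: "T (s n - x) = T (s n) - T x" for n using diff s by blast
  have conv: "convergent (\<lambda>n. T (s n - x))"
    unfolding eq using s by (intro convergent_diff convergent_const) auto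
  have "lim (\<lambda>n. T (s n - x)) = 0"
  proof -
    have "(\<lambda>n. s n - x) \<longlonglongrightarrow> 0" using s by (simp add: LIM_zero)
    moreover have "\<forall>n. s n - x \<in> S" using s x S by (simp add: subspace_diff)
    ultimately show ?thesis using clos conv unfolding closable_def
      by (elim allE[of _ "\<lambda>n. s n - x"]) auto
  qed
  with conv have "(\<lambda>n. T (s n) - T x) \<longlonglongrightarrow> 0"
    unfolding eq by (simp add: convergent_LIMSEQ_iff)
  then have "(\<lambda>n. T (s n)) \<longlonglongrightarrow> T x" by (simp add: LIM_zero_cancel)
  then show "gclos S T x = T x" unfolding gclos_def s_def[symmetric] by (rule limI)
qed

text \<open>For symmetric \<open>R\<close>,
  \<open>\<parallel>R\<^sup>2 u - r\<^sup>2 u\<parallel>\<^sup>2 \<le> r\<^sup>2 (r\<^sup>2 \<parallel>u\<parallel>\<^sup>2 - \<parallel>R u\<parallel>\<^sup>2)\<close>, which is small when \<open>u\<close> nearly attains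
  the norm \<open>r\<close> of \<open>R\<close>.\<close>
lemma symmetric_square_not_bounded_below:
  fixes R Q :: "'h::real_inner \<Rightarrow> 'h"
  assumes R: "bounded_linear R" and r: "onorm R > 0"
    and sym: "\<And>u v. u \<in> K \<Longrightarrow> v \<in> K \<Longrightarrow> inner (R u) v = inner u (R v)"
    and RK: "\<And>u. R u \<in> K" and QK: "\<And>u. Q u \<in> K" and RQ: "\<And>u. R (Q u) = R u"
    and Qle: "\<And>u. norm (Q u) \<le> norm u"
    and c: "c > 0" "\<And>u. u \<in> K \<Longrightarrow> c * norm u \<le> norm (R (R u) - (onorm R)\<^sup>2 *\<^sub>R u)"
  shows False
proof -
  define r where "r = onorm R"
  \<comment> \<open>The lower bound \<open>c\<close> yields the bound \<open>k\<close> for the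
    square of the norm of \<open>R\<close> on \<open>K\<close>, strictly below
    \<open>r\<^sup>2\<close>; the maximum with 0 keeps \<open>sqrt k\<close> nonnegative.\<close>
  define k where "k = max 0 (r\<^sup>2 - c\<^sup>2 / r\<^sup>2)"
  have rpos: "r > 0" using r by (simp add: r_def)
  have le: "(norm (R u))\<^sup>2 \<le> k * (norm u)\<^sup>2" if u: "u \<in> K" for u
  proof -
    have "(c * norm u)\<^sup>2 \<le> (norm (R (R u) - r\<^sup>2 *\<^sub>R u))\<^sup>2"
      using c(1) c(2)[OF u] by (intro power_mono) (auto simp: r_def)
    also have "\<dots> = (norm (R (R u)))\<^sup>2 - 2 * r\<^sup>2 * inner (R (R u)) u + (r\<^sup>2)\<^sup>2 * (norm u)\<^sup>2"
      unfolding power2_norm_eq_inner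
      by (simp add: inner_diff_left inner_diff_right inner_commute power2_eq_square algebra_simps)
    also have "inner (R (R u)) u = (norm (R u))\<^sup>2"
      using sym[OF RK u, of u] by (simp add: power2_norm_eq_inner)
    also have "norm (R (R u)) \<le> r * norm (R u)" unfolding r_def by (rule onorm[OF R])
    then have "(norm (R (R u)))\<^sup>2 \<le> r\<^sup>2 * (norm (R u))\<^sup>2"
      by (metis norm_ge_zero power_mono power_mult_distrib)
    finally have "c\<^sup>2 * (norm u)\<^sup>2 \<le> r\<^sup>2 * (r\<^sup>2 * (norm u)\<^sup>2 - (norm (R u))\<^sup>2)"
      by (simp add: power_mult_distrib power2_eq_square algebra_simps)
    then have "(norm (R u))\<^sup>2 \<le> (r\<^sup>2 - c\<^sup>2 / r\<^sup>2) * (norm u)\<^sup>2"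
      using rpos by (simp add: field_simps)
    also have "\<dots> \<le> k * (norm u)\<^sup>2" by (intro mult_right_mono) (auto simp: k_def)
    finally show ?thesis .
  qed
  \<comment> \<open>\<open>onorm\<close> ranges over the whole type, so the bound on
    \<open>K\<close> is transferred through the contraction \<open>Q\<close>.\<close>
  have "norm (R u) \<le> sqrt k * norm u" for u
  proof -
    have "(norm (R u))\<^sup>2 \<le> k * (norm (Q u))\<^sup>2" using le[OF QK, of u] RQ by simp
    also have "\<dots> \<le> k * (norm u)\<^sup>2"
      using Qle by (intro mult_left_mono power_mono) (auto simp: k_def)
    finally have "norm (R u) \<le> sqrt (k * (norm u)\<^sup>2)" by (rule real_le_rsqrt)
    then show ?thesis by (simp add: real_sqrt_mult)
  qed
  then have "r \<le> sqrt k" unfolding r_def by (intro onorm_bound) (auto simp: k_def)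
  then have "r\<^sup>2 \<le> k" by (metis rpos less_imp_le power_mono real_sqrt_pow2 k_def max.cobounded1)
  moreover have "k < r\<^sup>2" using rpos c(1) by (auto simp: k_def)
  ultimately show False by simp
qed

text \<open>If the resolvent \<open>R\<close> at \<open>l\<close> has norm \<open>r\<close>, then one of \<open>l - 1/r\<close>, \<open>l + 1/r\<close> is in the
  spectrum, because \<open>(R - r) (R + r)\<close> is not bounded below.\<close>
lemma self_adjoint_resolvent_bound:
  fixes T :: "'h::real_inner \<Rightarrow> 'h"
  assumes sa: "self_adjoint_in J K D T"
    and Q: "bounded_linear Q" "\<And>x. Q (Q x) = Q x" "\<And>x y. inner (Q x) y = inner x (Q y)" "K = range Q"
    and spec: "\<And>m. m \<in> spec_in K D T \<Longrightarrow> m \<le> d"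
    and l: "d < l" and x: "x \<in> D"
  shows "(l - d) * norm x \<le> norm (T x - l *\<^sub>R x)"
proof -
  interpret Q: bounded_linear Q by fact
  have sD: "subspace D" and DK: "D \<subseteq> K" and TK: "\<And>x. x \<in> D \<Longrightarrow> T x \<in> K"
    and add: "\<And>x y. x \<in> D \<Longrightarrow> y \<in> D \<Longrightarrow> T (x + y) = T x + T y"
    and scale: "\<And>x c. x \<in> D \<Longrightarrow> T (c *\<^sub>R x) = c *\<^sub>R T x"
    and sym: "\<And>x y. x \<in> D \<Longrightarrow> y \<in> D \<Longrightarrow> inner (T x) y = inner x (T y)"
    using sa unfolding self_adjoint_in_def clinear_on_def csubspace_def by auto
  have sK: "subspace K" unfolding Q(4) using Q.linear linear_subspace_image subspace_UNIV by blast
  have QK: "Q u = u" if "u \<in> K" for u using that Q by auto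
  have Qle: "norm (Q u) \<le> norm u" for u
  proof (cases "Q u = 0")
    case False
    have "norm (Q u) * norm (Q u) = inner u (Q u)"
      using Q(2,3) by (metis norm_eq_square power2_eq_square power2_norm_eq_inner)
    also have "\<dots> \<le> norm u * norm (Q u)" by (rule norm_cauchy_schwarz)
    finally show ?thesis using False by simp
  qed simp
  have bij: "bij_betw (\<lambda>x. T x - m *\<^sub>R x) D K"
    and bd: "\<exists>C. \<forall>x\<in>D. norm x \<le> C * norm (T x - m *\<^sub>R x)" if "d < m" for m
    using spec[of m] that unfolding spec_in_def by force+
  obtain C where C: "\<And>x. x \<in> D \<Longrightarrow> norm x \<le> C * norm (T x - l *\<^sub>R x)" using bd[OF l] by blast
  define S where "S = inv_into D (\<lambda>x. T x - l *\<^sub>R x)"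
  have S: "S y \<in> D" "T (S y) - l *\<^sub>R S y = y" if "y \<in> K" for y
    using bij[OF l] that unfolding S_def bij_betw_def
    using inv_into_into[of y "\<lambda>x. T x - l *\<^sub>R x" D] f_inv_into_f[of y "\<lambda>x. T x - l *\<^sub>R x" D]
    by auto
  have S': "S (T x - l *\<^sub>R x) = x" if "x \<in> D" for x
    using inv_into_f_f[of "\<lambda>x. T x - l *\<^sub>R x" D x] bij[OF l] that unfolding S_def bij_betw_def by simp
  \<comment> \<open>\<open>S\<close> is the resolvent at \<open>l\<close> on \<open>K\<close>;
    composing with the projection \<open>Q\<close> extends it to the whole type, where
    \<open>onorm\<close> applies.\<close>
  define R where "R y = S (Q y)" for y
  have QinK: "Q u \<in> K" for u by (simp add: Q(4))
  have RS: "R y = S y" if "y \<in> K" for y using that QK by (simp add: R_def)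
  have RD: "R u \<in> D" for u using S(1)[OF QinK] by (simp add: R_def)
  have RK: "R u \<in> K" for u using RD DK by auto
  have TR: "T (R y) = y + l *\<^sub>R R y" if "y \<in> K" for y
    using S(2)[OF that] RS[OF that] by (simp add: algebra_simps)
  have R_add: "R (u + v) = R u + R v" for u v
  proof -
    have "R u + R v = S (T (R u + R v) - l *\<^sub>R (R u + R v))"
      using S' RD sD by (simp add: subspace_add)
    also have "T (R u + R v) - l *\<^sub>R (R u + R v) = Q u + Q v"
      using S(2)[OF QinK, of u] S(2)[OF QinK, of v] RD add
      by (simp add: R_def algebra_simps)
    finally show ?thesis by (simp add: R_def Q.add)
  qed
  have R_scale: "R (c *\<^sub>R u) = c *\<^sub>R R u" for c u
  proof -
    have "c *\<^sub>R R u = S (T (c *\<^sub>R R u) - l *\<^sub>R (c *\<^sub>R R u))"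
      by (rule S'[OF subspace_scale[OF sD RD], symmetric])
    also have "T (c *\<^sub>R R u) - l *\<^sub>R (c *\<^sub>R R u) = c *\<^sub>R (T (R u) - l *\<^sub>R R u)"
      using RD scale by (simp add: algebra_simps)
    also have "\<dots> = c *\<^sub>R Q u" using S(2)[OF QinK, of u] by (simp add: R_def)
    finally show ?thesis by (simp add: R_def Q.scaleR)
  qed
  have R_bd: "norm (R u) \<le> norm u * \<bar>C\<bar>" for u
  proof -
    have "norm (R u) \<le> C * norm (Q u)" using C[OF RD, of u] S(2)[OF QinK, of u] by (simp add: R_def)
    also have "\<dots> \<le> \<bar>C\<bar> * norm u" using Qle by (intro mult_mono) auto
    finally show ?thesis by (simp add: mult.commute)
  qed
  have R: "bounded_linear R" by (rule bounded_linear_intro[OF R_add R_scale R_bd])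
  define r where "r = onorm R"
  have x_le: "norm x \<le> r * norm (T x - l *\<^sub>R x)"
  proof -
    have "T x - l *\<^sub>R x \<in> K" using x TK DK sK by (meson subsetD subspace_diff subspace_scale)
    then show ?thesis using S'[OF x] RS onorm[OF R, of "T x - l *\<^sub>R x"] by (simp add: r_def)
  qed
  have r0: "r \<ge> 0" unfolding r_def by (rule onorm_pos_le[OF R])
  \<comment> \<open>If \<open>r\<close> is at most \<open>1 / (l - d)\<close>, the bound is
    immediate; otherwise \<open>l - 1 / r\<close> and \<open>l + 1 / r\<close> both exceed
    \<open>d\<close> and so lie outside the spectrum.\<close>
  show ?thesis
  proof (cases "(l - d) * r \<le> 1")
    case True
    have "(l - d) * norm x \<le> (l - d) * (r * norm (T x - l *\<^sub>R x))"
      using x_le l by (intro mult_left_mono) auto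
    also have "\<dots> = ((l - d) * r) * norm (T x - l *\<^sub>R x)" by simp
    also have "\<dots> \<le> 1 * norm (T x - l *\<^sub>R x)" using True by (intro mult_right_mono) auto
    finally show ?thesis by simp
  next
    case False
    then have rpos: "r > 0" using r0 l by (cases "r = 0") auto
    \<comment> \<open>Applying \<open>T - (l + s / r)\<close> to \<open>R w\<close> gives
      \<open>w - (s / r) R w\<close>, a multiple of \<open>R w - s r w\<close>, so boundedness below
      passes to \<open>R - s r\<close> on \<open>K\<close>.\<close>
    have below: "\<exists>M>0. \<forall>w\<in>K. norm w \<le> M * norm (R w - (s * r) *\<^sub>R w)" if s: "s = 1 \<or> s = -1" for s
    proof -
      have "d < l + s / r" using False rpos l s by (auto simp: field_simps add_strict_increasing)
      then obtain C' where C': "\<And>x. x \<in> D \<Longrightarrow> norm x \<le> C' * norm (T x - (l + s / r) *\<^sub>R x)"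
        using bd by blast
      have "norm w \<le> (1 / r + \<bar>C'\<bar> / r\<^sup>2) * norm (R w - (s * r) *\<^sub>R w)" if w: "w \<in> K" for w
      proof -
        have ss: "s * s = 1" using s by auto
        have e: "w - (s / r) *\<^sub>R R w = (- (s / r)) *\<^sub>R (R w - (s * r) *\<^sub>R w)"
          using rpos ss by (simp add: algebra_simps)
        have n: "norm (w - (s / r) *\<^sub>R R w) = norm (R w - (s * r) *\<^sub>R w) / r"
          unfolding e using rpos s by auto
        have "norm (R w) \<le> C' * norm (w - (s / r) *\<^sub>R R w)"
          using C'[OF RD, of w] TR[OF w] by (simp add: algebra_simps)
        also have "\<dots> \<le> \<bar>C'\<bar> * norm (w - (s / r) *\<^sub>R R w)" by (intro mult_right_mono) auto
        finally have 1: "norm (R w) \<le> \<bar>C'\<bar> * norm (R w - (s * r) *\<^sub>R w) / r" by (simp add: n)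
        have "norm w \<le> norm (w - (s / r) *\<^sub>R R w) + norm ((s / r) *\<^sub>R R w)"
          using norm_triangle_ineq[of "w - (s / r) *\<^sub>R R w" "(s / r) *\<^sub>R R w"] by simp
        also have "norm ((s / r) *\<^sub>R R w) = norm (R w) / r" using s rpos by auto
        also have "norm (R w) / r \<le> \<bar>C'\<bar> * norm (R w - (s * r) *\<^sub>R w) / r / r"
          using 1 rpos by (intro divide_right_mono) auto
        finally show ?thesis by (simp add: n power2_eq_square algebra_simps)
      qed
      moreover have "1 / r + \<bar>C'\<bar> / r\<^sup>2 > 0" using rpos by (simp add: add_pos_nonneg)
      ultimately show ?thesis by blast
    qed
    obtain M where M: "M > 0" "\<And>w. w \<in> K \<Longrightarrow> norm w \<le> M * norm (R w - r *\<^sub>R w)"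
      using below[of 1] by auto
    obtain M' where M': "M' > 0" "\<And>w. w \<in> K \<Longrightarrow> norm w \<le> M' * norm (R w + r *\<^sub>R w)"
      using below[of "-1"] by auto
    \<comment> \<open>The lower bounds for \<open>R + r\<close> and \<open>R - r\<close> compose to
      one for their product.\<close>
    have "1 / (M * M') * norm u \<le> norm (R (R u) - (onorm R)\<^sup>2 *\<^sub>R u)" if u: "u \<in> K" for u
    proof -
      let ?v = "R u + r *\<^sub>R u"
      have v: "?v \<in> K" using u RK sK by (simp add: subspace_add subspace_scale)
      have e: "R ?v - r *\<^sub>R ?v = R (R u) - r\<^sup>2 *\<^sub>R u"
        by (simp add: R_add R_scale power2_eq_square algebra_simps)
      have "norm u \<le> M' * norm ?v" by (rule M'(2)[OF u])
      also have "\<dots> \<le> M' * (M * norm (R (R u) - r\<^sup>2 *\<^sub>R u))"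
        using M(2)[OF v] M'(1) unfolding e by (intro mult_left_mono) auto
      finally show ?thesis using M(1) M'(1) by (simp add: r_def field_simps)
    qed
    moreover have "inner (R u) v = inner u (R v)" if "u \<in> K" "v \<in> K" for u v
    proof -
      have "inner (R u) (T (R v) - l *\<^sub>R R v) = inner (T (R u) - l *\<^sub>R R u) (R v)"
        using sym[OF RD RD, of u v] by (simp add: inner_diff_left inner_diff_right)
      then show ?thesis using TR that by simp
    qed
    moreover have "R (Q u) = R u" for u by (simp add: R_def Q(2))
    ultimately have False
      using symmetric_square_not_bounded_below[OF R, of K Q "1 / (M * M')"] rpos RK QinK Qle M(1) M'(1)
      by (simp add: r_def)
    then show ?thesis ..
  qed
qed

text \<open>Squaring the resolvent bound cancels the terms in \<open>l\<^sup>2\<close> and leaves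
  \<open>2 * l * g \<le> c\<close> for all \<open>l > d\<close>. Letting \<open>l\<close> grow
  forces \<open>g \<le> 0\<close>.\<close>

lemma self_adjoint_form_le_Sup_spec:
  fixes T :: "'h::real_inner \<Rightarrow> 'h"
  assumes sa: "self_adjoint_in J K D T"
    and Q: "bounded_linear Q" "\<And>x. Q (Q x) = Q x" "\<And>x y. inner (Q x) y = inner x (Q y)" "K = range Q"
    and spec: "\<And>m. m \<in> spec_in K D T \<Longrightarrow> m \<le> d"
    and x: "x \<in> D"
  shows "inner (T x) x \<le> d * (norm x)\<^sup>2"
proof (rule ccontr)
  define g where "g = inner (T x) x - d * (norm x)\<^sup>2"
  define c where "c = (norm (T x))\<^sup>2 - d\<^sup>2 * (norm x)\<^sup>2"
  assume "\<not> ?thesis"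
  then have g: "g > 0" by (simp add: g_def)
  have key: "2 * l * g \<le> c" if l: "d < l" for l
  proof -
    have "((l - d) * norm x)\<^sup>2 \<le> (norm (T x - l *\<^sub>R x))\<^sup>2"
      using self_adjoint_resolvent_bound[OF sa Q spec l x] l by (intro power_mono) auto
    also have "\<dots> = (norm (T x))\<^sup>2 - 2 * l * inner (T x) x + l\<^sup>2 * (norm x)\<^sup>2"
      unfolding power2_norm_eq_inner
      by (simp add: inner_diff_left inner_diff_right inner_commute power2_eq_square algebra_simps)
    finally show ?thesis by (simp add: g_def c_def power2_eq_square algebra_simps)
  qed
  \<comment> \<open>Above \<open>d\<close>, and so large that \<open>l * g\<close> exceeds
    \<open>\<bar>c\<bar>\<close>.\<close>
  define l where "l = max (d + 1) ((\<bar>c\<bar> + 1) / g)"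
  have "(\<bar>c\<bar> + 1) / g \<le> l" by (simp add: l_def)
  then have "\<bar>c\<bar> + 1 \<le> l * g" using g by (simp add: field_simps)
  moreover have "2 * l * g \<le> c" by (rule key) (simp add: l_def)
  ultimately show False by linarith
qed

subsection \<open>Eigenvectors in balanced subspaces\<close>

text \<open>Collects what the eigenvector argument uses: symmetry of \<open>A\<close>, orthogonality
  of \<open>DL\<close> and \<open>L DL\<close> through \<open>P\<close>, and the spectral bound
  \<open>d\<close> as an inequality of quadratic forms.\<close>

locale pl_operator =
  fixes J :: "'h::{real_inner,complete_space} \<Rightarrow> 'h" and A :: "'h \<Rightarrow> 'h" and DA :: "'h set"
    and P :: "'h \<Rightarrow> 'h" and L :: "'h \<Rightarrow> 'h" and DL :: "'h set" and d :: real
  assumes cstruct_J: "cstruct J"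
    and A_lin: "clinear_on J DA A"
    and A_sym: "\<And>x y. x \<in> DA \<Longrightarrow> y \<in> DA \<Longrightarrow> inner (A x) y = inner x (A y)"
    and P_bl: "bounded_linear P" and P_idem: "\<And>x. P (P x) = P x"
    and P_sym: "\<And>x y. inner (P x) y = inner x (P y)"
    and L_lin: "clinear_on J DL L"
    and DL_P: "x \<in> DL \<Longrightarrow> P x = x" and PL: "x \<in> DL \<Longrightarrow> P (L x) = 0"
    and dsum_DA: "dsum DL L \<subseteq> DA"
    and form_le: "x \<in> DL \<Longrightarrow> inner (A (L x)) (L x) \<le> d * (norm (L x))\<^sup>2"
begin

definition eigpair :: "'h set \<Rightarrow> real \<Rightarrow> 'h \<Rightarrow> 'h \<Rightarrow> bool" where
  "eigpair V l p q \<longleftrightarrow> p \<in> V \<and> q \<in> V \<and>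
     (\<forall>w\<in>dsum V L. inner (A (p + L q) - l *\<^sub>R (p + L q)) w = 0)"

lemma J_simps: "J (x + y) = J x + J y" "J (c *\<^sub>R x) = c *\<^sub>R J x" "J (J x) = - x"
  using cstruct_J unfolding cstruct_def by (auto simp: linear_add linear_scale)

lemma J_skew: "inner (J x) y = - inner x (J y)"
proof -
  have "inner (J x) (J (J y)) = inner x (J y)" using cstruct_J unfolding cstruct_def by blast
  then show ?thesis by (simp add: J_simps)
qed

lemma A_simps:
  assumes "x \<in> DA"
  shows "y \<in> DA \<Longrightarrow> A (x + y) = A x + A y" "A (c *\<^sub>R x) = c *\<^sub>R A x" "A (J x) = J (A x)"
  using A_lin assms unfolding clinear_on_def by auto

lemma L_simps:
  assumes "x \<in> DL"
  shows "y \<in> DL \<Longrightarrow> L (x + y) = L x + L y" "L (c *\<^sub>R x) = c *\<^sub>R L x" "L (J x) = J (L x)"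
  using L_lin assms unfolding clinear_on_def by auto

lemma subspace_DL: "subspace DL"
  using L_lin by (simp add: clinear_on_def csubspace_def)

lemma L_0: "L 0 = 0"
  using L_simps(2)[of 0 0] subspace_0[OF subspace_DL] by simp

section \<open>Algebra of the subspaces \<open>dsum V L\<close>\<close>

lemma subspace_dsum:
  assumes V: "subspace V" "V \<subseteq> DL"
  shows "subspace (dsum V L)"
proof (rule subspaceI)
  show "0 \<in> dsum V L" unfolding dsum_def using subspace_0[OF V(1)] L_0 by force
next
  fix x y assume "x \<in> dsum V L" "y \<in> dsum V L"
  then obtain a b a' b' where *: "x = a + L b" "y = a' + L b'" "a \<in> V" "b \<in> V" "a' \<in> V" "b' \<in> V"
    by (auto simp: dsum_def)
  then have "L (b + b') = L b + L b'" using V L_simps(1) by blast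
  then have "x + y = (a + a') + L (b + b')" using * by simp
  then show "x + y \<in> dsum V L" unfolding dsum_def using * V(1) subspace_add by blast
next
  fix c x assume "x \<in> dsum V L"
  then obtain a b where *: "x = a + L b" "a \<in> V" "b \<in> V" by (auto simp: dsum_def)
  then have "c *\<^sub>R x = c *\<^sub>R a + L (c *\<^sub>R b)" using V(2) L_simps(2) by (auto simp: scaleR_add_right)
  then show "c *\<^sub>R x \<in> dsum V L" unfolding dsum_def using * V(1) subspace_scale by blast
qed

lemma dsum_mono: "V \<subseteq> W \<Longrightarrow> dsum V L \<subseteq> dsum W L"
  unfolding dsum_def by blast

lemma dsum_left: "subspace V \<Longrightarrow> x \<in> V \<Longrightarrow> x \<in> dsum V L"
  unfolding dsum_def using subspace_0 L_0 by force

lemma dsum_right: "subspace V \<Longrightarrow> x \<in> V \<Longrightarrow> L x \<in> dsum V L"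
  unfolding dsum_def using subspace_0 by force

lemma dsum_J:
  assumes V: "csubspace J V" "V \<subseteq> DL" and w: "w \<in> dsum V L"
  shows "J w \<in> dsum V L"
proof -
  obtain a b where *: "w = a + L b" "a \<in> V" "b \<in> V" using w by (auto simp: dsum_def)
  then have "J w = J a + L (J b)" using V(2) by (auto simp: J_simps L_simps)
  moreover have "J a \<in> V" "J b \<in> V" using V(1) * by (auto simp: csubspace_def)
  ultimately show ?thesis by (auto simp: dsum_def)
qed

lemma findim_dsum:
  assumes V: "findim V" "V \<subseteq> DL"
  shows "findim (dsum V L)"
proof -
  obtain B where B: "finite B" "V = span B" using V by (auto simp: findim_def)
  have sV: "subspace V" using B by simp
  \<comment> \<open>Membership in \<open>DL\<close> is carried through the induction because
    \<open>L\<close> is linear only there.\<close>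
  have "L x \<in> span (L ` B) \<and> x \<in> DL" if "x \<in> span B" for x
    using that
  proof (induction rule: span_induct_alt)
    case base then show ?case using L_0 subspace_DL by (simp add: span_zero subspace_0)
  next
    case (step c x y)
    have "x \<in> DL" using step.hyps V(2) B(2) span_base by blast
    then have "L (c *\<^sub>R x + y) = c *\<^sub>R L x + L y" "c *\<^sub>R x + y \<in> DL"
      using step.IH subspace_DL by (simp_all add: L_simps subspace_scale subspace_add)
    then show ?case using step by (simp add: span_add span_scale span_base)
  qed
  then have "dsum V L \<subseteq> span (B \<union> L ` B)"
    unfolding dsum_def B(2)
    by (clarsimp, intro span_add) (meson span_mono subsetD sup_ge1 sup_ge2)+
  moreover have "span (B \<union> L ` B) \<subseteq> dsum V L"
    using dsum_left[OF sV] dsum_right[OF sV] B(2) span_base subspace_dsum[OF sV V(2)]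
    by (intro span_minimal) blast+
  ultimately show ?thesis using B(1) unfolding findim_def by (intro exI[of _ "B \<union> L ` B"]) auto
qed

lemma compr_spec_ne_finite:
  assumes W: "findim W" "W \<subseteq> DA"
  shows "finite (compr_spec A W)" and "v \<in> W \<Longrightarrow> v \<noteq> 0 \<Longrightarrow> compr_spec A W \<noteq> {}"
proof -
  show "finite (compr_spec A W)" using W A_sym by (intro finite_compr_spec) auto
  show "compr_spec A W \<noteq> {}" if "v \<in> W" "v \<noteq> 0"
  proof (rule compr_spec_nonempty[OF W(1) that])
    fix x y and c :: real assume "x \<in> W"
    then show "A (c *\<^sub>R x) = c *\<^sub>R A x" using W(2) A_simps(2) by blast
    assume "y \<in> W"
    with \<open>x \<in> W\<close> have "x \<in> DA" "y \<in> DA" using W(2) by auto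
    then show "A (x + y) = A x + A y" "inner (A x) y = inner x (A y)"
      using A_simps(1) A_sym by blast+
  qed
qed

section \<open>Eigenpairs and their components\<close>

lemma eigpair_scale:
  assumes V: "subspace V" "V \<subseteq> DL" and e: "eigpair V l p q"
  shows "eigpair V l (c *\<^sub>R p) (c *\<^sub>R q)"
proof -
  have pq: "p \<in> V" "q \<in> V" using e by (auto simp: eigpair_def)
  have "p + L q \<in> dsum V L" using pq by (auto simp: dsum_def)
  then have uD: "p + L q \<in> DA" using dsum_mono[OF V(2)] dsum_DA by blast
  have "c *\<^sub>R p + L (c *\<^sub>R q) = c *\<^sub>R (p + L q)" using pq V(2) by (auto simp: L_simps scaleR_add_right)
  moreover have "A (c *\<^sub>R (p + L q)) - l *\<^sub>R (c *\<^sub>R (p + L q)) = c *\<^sub>R (A (p + L q) - l *\<^sub>R (p + L q))"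
    by (simp only: A_simps(2)[OF uD]) (simp add: algebra_simps)
  ultimately show ?thesis
    using e V(1) unfolding eigpair_def by (simp add: subspace_scale)
qed

text \<open>Otherwise \<open>L q\<close> alone would have Rayleigh quotient \<open>l > d\<close>,
  against \<open>form_le\<close>.\<close>

lemma eigpair_left_nonzero:
  assumes V: "subspace V" "V \<subseteq> DL" and e: "eigpair V l p q" and l: "d < l" and nz: "p + L q \<noteq> 0"
  shows "p \<noteq> 0"
proof
  assume p: "p = 0"
  have q: "q \<in> V" using e by (simp add: eigpair_def)
  have "inner (A (L q) - l *\<^sub>R L q) (L q) = 0"
    using e dsum_right[OF V(1) q] p by (simp add: eigpair_def)
  then have "l * (norm (L q))\<^sup>2 \<le> d * (norm (L q))\<^sup>2"
    using form_le[of q] q V(2) by (auto simp: inner_diff_left power2_norm_eq_inner)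
  then show False using l nz p by (simp add: mult_le_cancel_right)
qed

text \<open>Testing the equation against \<open>p\<close> and against \<open>L q\<close> and
  subtracting cancels the cross terms by symmetry: the form of \<open>A - l\<close> takes the same
  value at \<open>p\<close> and at \<open>L q\<close>.\<close>

lemma eigpair_form_left:
  assumes V: "subspace V" "V \<subseteq> DL" and e: "eigpair V l p q"
  shows "inner (A p) p - l * (norm p)\<^sup>2 \<le> (d - l) * (norm (L q))\<^sup>2"
proof -
  have pq: "p \<in> V" "q \<in> V" using e by (auto simp: eigpair_def)
  have D: "p \<in> DA" "L q \<in> DA"
    using dsum_left[OF V(1)] dsum_right[OF V(1)] pq dsum_mono[OF V(2)] dsum_DA by blast+
  have "inner (A (p + L q) - l *\<^sub>R (p + L q)) p = 0"
    "inner (A (p + L q) - l *\<^sub>R (p + L q)) (L q) = 0"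
    using e dsum_left[OF V(1)] dsum_right[OF V(1)] pq unfolding eigpair_def by blast+
  moreover have "inner (A p) (L q) = inner (A (L q)) p" using A_sym[OF D] by (simp add: inner_commute)
  moreover have "inner (A (L q)) (L q) \<le> d * (norm (L q))\<^sup>2" using form_le pq V(2) by blast
  ultimately show ?thesis
    using D by (simp add: A_simps inner_diff_left inner_add_left inner_add_right
        power2_norm_eq_inner inner_commute algebra_simps)
qed

lemma norm_PL_sum:
  assumes "p \<in> DL" "q \<in> DL"
  shows "(norm (p + L q))\<^sup>2 = (norm p)\<^sup>2 + (norm (L q))\<^sup>2"
proof -
  have "inner p (L q) = 0" using P_sym[of p "L q"] DL_P PL assms by simp
  then show ?thesis by (simp add: power2_norm_eq_inner inner_add_left inner_add_right inner_commute)
qed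

text \<open>Every \<open>v\<close> in the complex span of \<open>p\<close> and \<open>L p\<close> differs from a complex multiple of the
  eigenvector \<open>p + L q\<close> by an element \<open>L r\<close>, and the form of \<open>A - l\<close> at \<open>v\<close> equals that at
  \<open>L r\<close>, which is nonpositive.\<close>
lemma mu2_le_eigenvalue:
  assumes V: "csubspace J V" "V \<subseteq> DL" and e: "eigpair V l p q" and l: "d < l" and p0: "p \<noteq> 0"
  shows "mu2 J A L p \<le> l"
proof -
  have sV: "subspace V" using V by (simp add: csubspace_def)
  note sW = subspace_dsum[OF sV V(2)]
  have JV: "J x \<in> V" if "x \<in> V" for x using V that by (simp add: csubspace_def)
  have WA: "dsum V L \<subseteq> DA" using dsum_mono[OF V(2)] dsum_DA by blast
  have pq: "p \<in> V" "q \<in> V" using e by (auto simp: eigpair_def)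
  define u where "u = p + L q"
  have uW: "u \<in> dsum V L" using pq by (auto simp: dsum_def u_def)
  have eig: "inner (A u - l *\<^sub>R u) w = 0" if "w \<in> dsum V L" for w
    using e that by (simp add: eigpair_def u_def)
  define W where "W = cspan2 J p (L p)"
  have fW: "findim W" unfolding W_def cspan2_def findim_def
    by (intro exI[of _ "{p, J p, L p, J (L p)}"]) simp
  have W_sub: "W \<subseteq> dsum V L"
  proof -
    have "p \<in> dsum V L" "J p \<in> dsum V L" "L p \<in> dsum V L"
      using dsum_left[OF sV] dsum_right[OF sV] pq JV by blast+
    moreover from this(3) have "J (L p) \<in> dsum V L" by (rule dsum_J[OF V])
    ultimately show ?thesis unfolding W_def cspan2_def using sW by (intro span_minimal) auto
  qed
  have pW: "p \<in> W" unfolding W_def cspan2_def by (simp add: span_base)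
  have "m \<le> l" if m: "m \<in> compr_spec A W" for m
  proof -
    obtain v where v: "v \<in> W" "v \<noteq> 0" and veig: "\<And>w. w \<in> W \<Longrightarrow> inner (A v - m *\<^sub>R v) w = 0"
      using m compr_spec_iff[OF fW] by metis
    obtain a b c e where v_eq: "v = a *\<^sub>R p + b *\<^sub>R J p + c *\<^sub>R L p + e *\<^sub>R J (L p)"
      using v(1) unfolding W_def cspan2_def by (auto simp: span_insert algebra_simps)
    \<comment> \<open>The complex multiple of \<open>u\<close> with the same part in
      \<open>DL\<close> as \<open>v\<close>. The vector \<open>r\<close> is chosen so that
      \<open>L r = v - y\<close>: it keeps the \<open>L p\<close> terms of \<open>v\<close> and
      removes the \<open>L q\<close> terms of \<open>y\<close>.\<close>
    define y where "y = a *\<^sub>R u + b *\<^sub>R J u"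
    define r where "r = (c *\<^sub>R p + e *\<^sub>R J p) + ((-a) *\<^sub>R q + (-b) *\<^sub>R J q)"
    have rV: "r \<in> V" unfolding r_def using pq JV sV by (intro subspace_add subspace_scale)
    have yW: "y \<in> dsum V L" unfolding y_def
      using uW dsum_J[OF V uW] sW by (intro subspace_add subspace_scale)
    define z where "z = L r"
    have zW: "z \<in> dsum V L" unfolding z_def by (rule dsum_right[OF sV rV])
    have inDL: "x \<in> DL" if "x \<in> V" for x using that V(2) by blast
    have "z = c *\<^sub>R L p + e *\<^sub>R J (L p) - a *\<^sub>R L q - b *\<^sub>R J (L q)"
    proof -
      have mem: "c *\<^sub>R p + e *\<^sub>R J p \<in> V" "(-a) *\<^sub>R q + (-b) *\<^sub>R J q \<in> V" "c *\<^sub>R p \<in> V" "e *\<^sub>R J p \<in> V"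
          "(-a) *\<^sub>R q \<in> V" "(-b) *\<^sub>R J q \<in> V"
        by (intro subspace_add[OF sV] subspace_scale[OF sV] pq JV)+
      have "z = (L (c *\<^sub>R p) + L (e *\<^sub>R J p)) + (L ((-a) *\<^sub>R q) + L ((-b) *\<^sub>R J q))"
        unfolding z_def r_def using mem inDL L_simps(1) by metis
      also have "L (c *\<^sub>R p) = c *\<^sub>R L p" using L_simps(2) inDL pq by blast
      also have "L (e *\<^sub>R J p) = e *\<^sub>R J (L p)" using L_simps(2,3) inDL pq JV by metis
      also have "L ((-a) *\<^sub>R q) = (-a) *\<^sub>R L q" using L_simps(2) inDL pq by blast
      also have "L ((-b) *\<^sub>R J q) = (-b) *\<^sub>R J (L q)" using L_simps(2,3) inDL pq JV by metis
      finally show ?thesis by simp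
    qed
    then have vyz: "v = y + z" by (simp add: v_eq y_def u_def J_simps algebra_simps)
    have yz: "y \<in> DA" "z \<in> DA" "u \<in> DA" "J u \<in> DA" using yW zW uW dsum_J[OF V uW] WA by blast+
    have Ay: "A y = a *\<^sub>R A u + b *\<^sub>R J (A u)"
      unfolding y_def using yz A_lin by (simp add: A_simps clinear_on_def csubspace_def subspace_scale)
    have JAu: "J (A u - l *\<^sub>R u) = J (A u) - l *\<^sub>R J u"
      using J_simps(1)[of "A u" "(-l) *\<^sub>R u"] J_simps(2)[of "-l" u] by simp
    have "A y - l *\<^sub>R y = a *\<^sub>R (A u - l *\<^sub>R u) + b *\<^sub>R J (A u - l *\<^sub>R u)"
      unfolding Ay JAu by (simp add: y_def algebra_simps)
    \<comment> \<open>By skewness \<open>J\<close> moves onto the test vector, and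
      \<open>dsum V L\<close> is invariant under \<open>J\<close>.\<close>
    then have yeig: "inner (A y - l *\<^sub>R y) w = 0" if "w \<in> dsum V L" for w
      using eig[OF that] eig[OF dsum_J[OF V that]] by (simp add: inner_add_left J_skew)
    \<comment> \<open>Symmetry puts both cross terms on \<open>A y - l y\<close>, where the
      eigenvalue equation annihilates them.\<close>
    have "inner (A v - l *\<^sub>R v) v = inner (A y - l *\<^sub>R y) (y + z) + inner (A y - l *\<^sub>R y) z
        + inner (A z - l *\<^sub>R z) z"
      using A_sym[OF yz(1,2)] yz unfolding vyz
      by (simp add: A_simps inner_add_left inner_add_right inner_diff_left inner_commute algebra_simps)
    also have "\<dots> = inner (A z - l *\<^sub>R z) z"
      using yeig zW yW sW by (simp add: subspace_add)
    also have "\<dots> \<le> (d - l) * (norm z)\<^sup>2"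
      using form_le[of r] rV V(2) unfolding z_def
      by (auto simp: inner_diff_left power2_norm_eq_inner algebra_simps)
    also have "\<dots> \<le> 0" using l by (simp add: mult_nonpos_nonneg)
    finally have "inner (A v) v \<le> l * inner v v" by (simp add: inner_diff_left)
    moreover have "inner (A v) v = m * inner v v" using veig[OF v(1)] by (simp add: inner_diff_left)
    ultimately show ?thesis using v(2) by simp
  qed
  moreover have "W \<subseteq> DA" using W_sub WA by blast
  \<comment> \<open>Since \<open>W\<close> contains the nonzero \<open>p\<close>, its spectrum is
    nonempty and finite, and \<open>Max\<close> is a genuine eigenvalue.\<close>
  then have "Max (compr_spec A W) \<in> compr_spec A W"
    using compr_spec_ne_finite[OF fW] pW p0 by (intro Max_in) blast+
  ultimately show ?thesis unfolding mu2_def W_def[symmetric] by blast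
qed

section \<open>Eigenvector sequences attached to a spurious point\<close>

text \<open>For each subspace an eigenvalue nearest to \<open>l\<close> is chosen, with a normalised
  eigenvector. Finitely many initial subspaces are dropped so that all these eigenvalues exist and
  exceed \<open>d\<close>.\<close>

lemma spurious_eigpairs:
  assumes l: "l \<in> Spu J DA A DL L" "d < l" and nontriv: "x0 \<in> DA" "x0 \<noteq> 0"
  shows "\<exists>V lam p q. (\<forall>n. csubspace J (V n) \<and> V n \<subseteq> DL \<and> V n \<subseteq> V (Suc n)) \<and>
    graph_dense DA A (\<Union>n. dsum (V n) L) \<and> lam \<longlonglongrightarrow> l \<and>
    (\<forall>n. d < lam n \<and> eigpair (V n) (lam n) (p n) (q n) \<and> norm (p n + L (q n)) = 1)"
proof -
  obtain V :: "nat \<Rightarrow> 'h set" where V: "\<And>n. csubspace J (V n)" "\<And>n. findim (V n)" "\<And>n. V n \<subseteq> DL"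
      "\<And>n. V n \<subseteq> V (Suc n)" and dense: "graph_dense DA A (\<Union>n. dsum (V n) L)"
      and lim: "(\<lambda>n. infdist l (compr_spec A (dsum (V n) L))) \<longlonglongrightarrow> 0"
    using l(1) unfolding Spu_def by auto
  have mono: "V m \<subseteq> V n" if "m \<le> n" for m n using lift_Suc_mono_le[of V, OF V(4) that] .
  have sV: "subspace (V n)" for n using V(1) by (simp add: csubspace_def)
  have WA: "dsum (V n) L \<subseteq> DA" for n using dsum_mono[OF V(3)] dsum_DA by blast
  \<comment> \<open>\<open>infdist\<close> to the empty set is 0 by convention, so nonemptiness of
    the spectra needs an argument: a \<open>y\<close> closer to \<open>x0\<close> than
    \<open>norm x0\<close> is nonzero, and it lies in all late subspaces.\<close>
  obtain y where y: "y \<in> (\<Union>n. dsum (V n) L)" "sqrt ((norm (x0 - y))\<^sup>2 + (norm (A x0 - A y))\<^sup>2) < norm x0"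
    using dense nontriv unfolding graph_dense_def by (meson zero_less_norm_iff)
  have "norm (x0 - y) < norm x0" 
    using y(2) real_sqrt_ge_abs1[of "norm (x0 - y)" "norm (A x0 - A y)"] by linarith
  then have "y \<noteq> 0" by auto
  obtain N1 where N1: "y \<in> dsum (V N1) L" using y(1) by blast
  \<comment> \<open>An eigenvalue at distance less than \<open>l - d\<close> from \<open>l\<close>
    lies above \<open>d\<close>.\<close>
  obtain N2 where N2: "\<And>n. n \<ge> N2 \<Longrightarrow> infdist l (compr_spec A (dsum (V n) L)) < l - d"
    using order_tendstoD(2)[OF lim, of "l - d"] l(2) by (auto simp: eventually_sequentially)
  define N where "N = max N1 N2"
  have "\<exists>m p q. d < m \<and> dist l m = infdist l (compr_spec A (dsum (V (n + N)) L))
      \<and> eigpair (V (n + N)) m p q \<and> norm (p + L q) = 1" for n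
  proof -
    let ?V = "V (n + N)" and ?W = "dsum (V (n + N)) L"
    have "N1 \<le> n + N" by (simp add: N_def)
    then have "y \<in> ?W" using N1 dsum_mono[OF mono] by blast
    then have ne: "compr_spec A ?W \<noteq> {}" and fin: "finite (compr_spec A ?W)"
      using compr_spec_ne_finite[OF findim_dsum[OF V(2,3)] WA] \<open>y \<noteq> 0\<close> by blast+
    obtain m where m: "m \<in> compr_spec A ?W" "infdist l (compr_spec A ?W) = dist l m"
      using infdist_attains_inf[OF finite_imp_closed[OF fin] ne] by metis
    have "dist l m < l - d" using N2[of "n + N"] m(2) by (simp add: N_def)
    then have dm: "d < m" by (simp add: dist_real_def)
    obtain v where v: "v \<in> ?W" "v \<noteq> 0" "\<forall>w\<in>?W. inner (A v - m *\<^sub>R v) w = 0"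
      using m(1) compr_spec_iff[OF findim_dsum[OF V(2,3)]] by metis
    obtain p q where pq: "v = p + L q" "p \<in> ?V" "q \<in> ?V" using v(1) by (auto simp: dsum_def)
    define c where "c = inverse (norm v)"
    have "eigpair ?V m (c *\<^sub>R p) (c *\<^sub>R q)"
      using eigpair_scale[OF sV V(3)] v(3) pq by (simp add: eigpair_def)
    moreover have "q \<in> DL" using pq V(3) by blast
    then have "c *\<^sub>R p + L (c *\<^sub>R q) = c *\<^sub>R v"
      using pq by (simp add: L_simps scaleR_add_right)
    then have "norm (c *\<^sub>R p + L (c *\<^sub>R q)) = 1" using v(2) by (simp add: c_def)
    ultimately show ?thesis using dm m(2) by metis
  qed
  then obtain lam p q where *: "\<And>n. d < lam n"
      "\<And>n. dist l (lam n) = infdist l (compr_spec A (dsum (V (n + N)) L))"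
      "\<And>n. eigpair (V (n + N)) (lam n) (p n) (q n)" "\<And>n. norm (p n + L (q n)) = 1"
    by metis
  show ?thesis
  proof (rule exI[of _ "\<lambda>n. V (n + N)"], rule exI[of _ lam], rule exI[of _ p], rule exI[of _ q],
      intro conjI)
    have "(\<lambda>n. dist l (lam n)) \<longlonglongrightarrow> 0"
      unfolding *(2) using LIMSEQ_ignore_initial_segment[OF lim, of N] .
    then show "lam \<longlonglongrightarrow> l" by (subst tendsto_dist_iff) (simp add: dist_commute)
    have "(\<Union>n. dsum (V n) L) \<subseteq> (\<Union>n. dsum (V (n + N)) L)"
      using dsum_mono[OF mono] by (meson UN_mono le_add1 subset_UNIV)
    then show "graph_dense DA A (\<Union>n. dsum (V (n + N)) L)"
      using dense unfolding graph_dense_def by (meson subsetD)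
  qed (use V * in auto)
qed

text \<open>Any \<open>h\<close> is \<open>(A - l) x\<close>, and \<open>x\<close> is close in graph
  norm to some \<open>y\<close> in one of the subspaces. Against \<open>(A - l) y\<close> the
  eigenvectors pair to \<open>(lam n - l)\<close> times a bounded factor.\<close>

lemma eigvecs_weak_to_zero:
  assumes V: "\<And>n. V n \<subseteq> DL" "\<And>n. V n \<subseteq> V (Suc n)"
    and dense: "graph_dense DA A (\<Union>n. dsum (V n) L)"
    and lam: "lam \<longlonglongrightarrow> l" and e: "\<And>n. eigpair (V n) (lam n) (p n) (q n)"
    and nrm: "\<And>n. norm (p n + L (q n)) = 1"
    and surj: "(\<lambda>x. A x - l *\<^sub>R x) ` DA = UNIV"
  shows "weak_to_zero (\<lambda>n. p n + L (q n))"
  unfolding weak_to_zero_def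
proof
  fix h
  define u where "u n = p n + L (q n)" for n
  have mono: "V m \<subseteq> V n" if "m \<le> n" for m n using lift_Suc_mono_le[of V, OF V(2) that] .
  obtain x where x: "x \<in> DA" "A x - l *\<^sub>R x = h"   proof -
    have "h \<in> (\<lambda>x. A x - l *\<^sub>R x) ` DA" using surj by simp
    then show ?thesis using that by blast
  qed
  have "(\<lambda>n. inner (u n) h) \<longlonglongrightarrow> 0"
  proof (rule LIMSEQ_I)
    fix r :: real assume r: "0 < r"
    \<comment> \<open>\<open>k\<close> bounds \<open>A - l\<close> by the graph norm, so
      approximating \<open>x\<close> within \<open>\<epsilon>\<close> costs at most
      \<open>r / 2\<close> in \<open>h\<close>.\<close>
    define k where "k = 1 + \<bar>l\<bar>"
    have k: "k > 0" by (simp add: k_def add_pos_nonneg)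
    define \<epsilon> where "\<epsilon> = r / (2 * k)"
    have \<epsilon>: "\<epsilon> > 0" using r k by (simp add: \<epsilon>_def)
    obtain y j where y: "y \<in> dsum (V j) L" "sqrt ((norm (x - y))\<^sup>2 + (norm (A x - A y))\<^sup>2) < \<epsilon>"
      using dense x(1) \<epsilon> unfolding graph_dense_def by blast
    have near: "norm (x - y) < \<epsilon>" "norm (A x - A y) < \<epsilon>"
      using y(2) real_sqrt_ge_abs1[of "norm (x - y)" "norm (A x - A y)"]
        real_sqrt_ge_abs2[of "norm (A x - A y)" "norm (x - y)"] by linarith+
    have "norm (h - (A y - l *\<^sub>R y)) = norm ((A x - A y) - l *\<^sub>R (x - y))"
      using x(2) by (simp add: algebra_simps)
    also have "\<dots> \<le> norm (A x - A y) + \<bar>l\<bar> * norm (x - y)"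
      using norm_triangle_ineq4[of "A x - A y" "l *\<^sub>R (x - y)"] by simp
    also have "\<dots> \<le> \<epsilon> + \<bar>l\<bar> * \<epsilon>" using near by (intro add_mono mult_left_mono) auto
    also have "\<epsilon> + \<bar>l\<bar> * \<epsilon> = \<epsilon> * k" by (simp add: k_def algebra_simps)
    also have "\<epsilon> * k = r / 2" using k by (simp add: \<epsilon>_def)
    finally have hy: "norm (h - (A y - l *\<^sub>R y)) \<le> r / 2" .
    \<comment> \<open>The extra 1 keeps the denominator positive when \<open>y\<close> is 0.\<close>
    obtain N where N: "\<And>n. n \<ge> N \<Longrightarrow> \<bar>lam n - l\<bar> < r / (2 * (norm y + 1))"
      using LIMSEQ_D[OF lam, of "r / (2 * (norm y + 1))"] r by (auto simp: add_nonneg_pos)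
    show "\<exists>no. \<forall>n\<ge>no. norm (inner (u n) h - 0) < r"
    proof (intro exI allI impI)
      fix n assume n: "max j N \<le> n"
      have yW: "y \<in> dsum (V n) L" using y(1) dsum_mono[OF mono[of j n]] n by auto
      have uW: "u n \<in> dsum (V n) L" using e[of n] by (auto simp: eigpair_def dsum_def u_def)
      have D: "y \<in> DA" "u n \<in> DA" using yW uW dsum_mono[OF V(1)] dsum_DA by blast+
      \<comment> \<open>Since \<open>n \<ge> j\<close>, \<open>y\<close> is an admissible test
        vector; symmetry then moves \<open>A\<close> onto it.\<close>
      have "inner (A (u n) - lam n *\<^sub>R u n) y = 0" using e[of n] yW by (simp add: eigpair_def u_def)
      then have uy: "inner (u n) (A y - l *\<^sub>R y) = (lam n - l) * inner (u n) y"
        using A_sym[OF D(2,1)] by (simp add: inner_diff_left inner_diff_right algebra_simps)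
      have "\<bar>inner (u n) y\<bar> \<le> norm y" using Cauchy_Schwarz_ineq2[of "u n" y] nrm by (simp add: u_def)
      then have "\<bar>lam n - l\<bar> * \<bar>inner (u n) y\<bar> \<le> \<bar>lam n - l\<bar> * (norm y + 1)"
        by (intro mult_left_mono) auto
      also have "\<dots> < r / (2 * (norm y + 1)) * (norm y + 1)"
        using N[of n] n by (intro mult_strict_right_mono) (auto simp: add_nonneg_pos)
      also have "\<dots> = r / 2"
        using norm_ge_zero[of y] by (simp add: field_simps add_nonneg_eq_0_iff)
      finally have 2: "\<bar>inner (u n) (A y - l *\<^sub>R y)\<bar> < r / 2" by (simp add: uy abs_mult)
      have "\<bar>inner (u n) (h - (A y - l *\<^sub>R y))\<bar> \<le> r / 2"
        using Cauchy_Schwarz_ineq2[of "u n" "h - (A y - l *\<^sub>R y)"] nrm[of n] hy by (simp add: u_def)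
      moreover have "inner (u n) h = inner (u n) (h - (A y - l *\<^sub>R y)) + inner (u n) (A y - l *\<^sub>R y)"
        by (simp add: inner_diff_right)
      ultimately have "\<bar>inner (u n) h\<bar> < r" using 2 by linarith
      then show "norm (inner (u n) h - 0) < r" by simp
    qed
  qed
  then show "(\<lambda>n. inner (p n + L (q n)) h) \<longlonglongrightarrow> 0" by (simp add: u_def)
qed

section \<open>Absence of spurious eigenvalues\<close>

text \<open>Each eigenpair gives a nonzero \<open>p n\<close> in \<open>DL\<close> with
  \<open>mu2\<close> at most \<open>lam n\<close>, so the infimum is at most every
  \<open>lam n\<close> and hence at most their limit \<open>l\<close>.\<close>

lemma no_spurious_below_Inf_mu2:
  assumes nontriv: "x0 \<in> DA" "x0 \<noteq> 0"
    and l: "d < l" "ereal l < Inf ((\<lambda>x. ereal (mu2 J A L x)) ` (DL - {0}))"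
  shows "l \<notin> Spu J DA A DL L"
proof
  assume spu: "l \<in> Spu J DA A DL L"
  obtain V lam p q where *: "\<forall>n. csubspace J (V n) \<and> V n \<subseteq> DL \<and> V n \<subseteq> V (Suc n)"
      "graph_dense DA A (\<Union>n. dsum (V n) L)" and lam_lim: "lam \<longlonglongrightarrow> l"
      and **: "\<forall>n. d < lam n \<and> eigpair (V n) (lam n) (p n) (q n) \<and> norm (p n + L (q n)) = 1"
    using spurious_eigpairs[OF spu l(1) nontriv] by (elim exE conjE)
  have V: "\<And>n. csubspace J (V n)" "\<And>n. V n \<subseteq> DL" "\<And>n. V n \<subseteq> V (Suc n)"
    using * by simp_all
  have lam: "lam \<longlonglongrightarrow> l" "\<And>n. d < lam n" and e: "\<And>n. eigpair (V n) (lam n) (p n) (q n)"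
    and nrm: "\<And>n. norm (p n + L (q n)) = 1" using ** lam_lim by simp_all
  have "Inf ((\<lambda>x. ereal (mu2 J A L x)) ` (DL - {0})) \<le> ereal (lam n)" for n
  proof -
    have "p n + L (q n) \<noteq> 0" using nrm[of n] by auto
    then have p0: "p n \<noteq> 0" using eigpair_left_nonzero[OF _ V(2) e lam(2)] V(1) csubspace_def by blast
    have "p n \<in> DL - {0}" using p0 e[of n] V(2) by (auto simp: eigpair_def)
    then have "Inf ((\<lambda>x. ereal (mu2 J A L x)) ` (DL - {0})) \<le> ereal (mu2 J A L (p n))"
      by (rule INF_lower)
    also have "\<dots> \<le> ereal (lam n)" using mu2_le_eigenvalue[OF V(1,2) e lam(2) p0] by simp
    finally show ?thesis .
  qed
  then have "Inf ((\<lambda>x. ereal (mu2 J A L x)) ` (DL - {0})) \<le> ereal l"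
    using lam(1) by (intro LIMSEQ_le_const[of "\<lambda>n. ereal (lam n)"]) auto
  then show False using l(2) by simp
qed

text \<open>The infimum excludes components in \<open>DL\<close> whose norms stay away from 0 along
  a subsequence, and \<open>strong\<close> excludes components tending to 0. Taking \<open>b\<close>
  in \<open>ereal\<close> includes the infinite case.\<close>

lemma no_spurious_below_weak_mu2:
  assumes nontriv: "x0 \<in> DA" "x0 \<noteq> 0"
    and l: "d < l" "ereal l < Inf {liminf (\<lambda>n. ereal (mu2 J A L (x n))) | x.
                     (\<forall>n. x n \<in> DL - {0} \<and> norm (x n) = 1) \<and> weak_to_zero x}"
    and b: "ereal l < b"
    and strong: "\<And>x. (\<forall>n. x n \<in> DL - {0}) \<Longrightarrow> x \<longlonglongrightarrow> 0 \<Longrightarrow>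
             limsup (\<lambda>n. ereal (mu2 J A L (x n))) < b \<Longrightarrow> (\<lambda>n. inner (A (x n)) (x n)) \<longlonglongrightarrow> 0"
  shows "l \<notin> Spu J DA A DL L"
proof
  assume spu: "l \<in> Spu J DA A DL L"
  obtain V lam p q where *: "\<forall>n. csubspace J (V n) \<and> V n \<subseteq> DL \<and> V n \<subseteq> V (Suc n)"
      and dense: "graph_dense DA A (\<Union>n. dsum (V n) L)" and lam_lim: "lam \<longlonglongrightarrow> l"
      and **: "\<forall>n. d < lam n \<and> eigpair (V n) (lam n) (p n) (q n) \<and> norm (p n + L (q n)) = 1"
    using spurious_eigpairs[OF spu l(1) nontriv] by (elim exE conjE)
  have V: "\<And>n. csubspace J (V n)" "\<And>n. V n \<subseteq> DL" "\<And>n. V n \<subseteq> V (Suc n)"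
    using * by simp_all
  have lam: "lam \<longlonglongrightarrow> l" "\<And>n. d < lam n" and e: "\<And>n. eigpair (V n) (lam n) (p n) (q n)"
    and nrm: "\<And>n. norm (p n + L (q n)) = 1" using ** lam_lim by simp_all
  have sV: "subspace (V n)" for n using V(1) by (simp add: csubspace_def)
  have pq: "p n \<in> DL" "q n \<in> DL" for n using e[of n] V(2) by (auto simp: eigpair_def)
  have p0: "p n \<noteq> 0" for n
  proof -
    have "p n + L (q n) \<noteq> 0" using nrm[of n] by auto
    then show ?thesis using eigpair_left_nonzero[OF sV V(2) e lam(2)] by blast
  qed
  have "(\<lambda>x. A x - l *\<^sub>R x) ` DA = UNIV"
    using spu unfolding Spu_def spec_in_def by (auto simp: bij_betw_def)
  then have weak: "weak_to_zero (\<lambda>n. p n + L (q n))"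
    using eigvecs_weak_to_zero[OF V(2,3) dense lam(1) e nrm] by blast
  \<comment> \<open>Weak convergence passes to the components because pairing \<open>p n\<close>
    with \<open>h\<close> is pairing the eigenvector with \<open>P h\<close>.\<close>
  have weak_p: "(\<lambda>n. inner (p n) h) \<longlonglongrightarrow> 0" for h
  proof -
    have "inner (p n + L (q n)) (P h) = inner (p n) h" for n
      using P_sym[of "p n + L (q n)" h] pq DL_P PL P_bl
      by (simp add: linear_add bounded_linear.linear)
    moreover have "(\<lambda>n. inner (p n + L (q n)) (P h)) \<longlonglongrightarrow> 0"
      using weak unfolding weak_to_zero_def by blast
    ultimately show ?thesis by simp
  qed
  have p_lim: "p \<longlonglongrightarrow> 0"
  proof (rule ccontr)
    assume "\<not> p \<longlonglongrightarrow> 0"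
    then obtain \<epsilon> where \<epsilon>: "\<epsilon> > 0" and "\<forall>N. \<exists>n\<ge>N. \<epsilon> \<le> norm (p n)"
      by (auto simp: LIMSEQ_iff not_less)
    then have "\<exists>\<^sub>F n in sequentially. \<epsilon> \<le> norm (p n)"
      by (simp add: frequently_sequentially)
    then have "infinite {n. \<epsilon> \<le> norm (p n)}"
      by (simp add: frequently_cofinite cofinite_eq_sequentially[symmetric])
    then obtain s :: "nat \<Rightarrow> nat" where s: "strict_mono s" "\<And>n. \<epsilon> \<le> norm (p (s n))"
      using infinite_enumerate by blast
    \<comment> \<open>The norms along the subsequence stay above \<open>\<epsilon>\<close>, so these
      factors are at most \<open>inverse \<epsilon>\<close> and normalising preserves weak
      convergence to 0.\<close>
    define c where "c n = inverse (norm (p (s n)))" for n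
    define x where "x n = c n *\<^sub>R p (s n)" for n
    have nz: "norm (p (s n)) \<noteq> 0" for n using p0 by simp
    have x1: "norm (x n) = 1" for n using nz by (simp add: x_def c_def)
    have x0: "x n \<noteq> 0" for n using x1[of n] by auto
    have xDL: "x n \<in> DL" for n unfolding x_def using pq subspace_DL by (simp add: subspace_scale)
    have "weak_to_zero x"
      unfolding weak_to_zero_def
    proof
      fix h
      have "(\<lambda>n. inverse \<epsilon> * inner (p (s n)) h) \<longlonglongrightarrow> inverse \<epsilon> * 0"
        using LIMSEQ_subseq_LIMSEQ[OF weak_p s(1), of h] by (intro tendsto_mult_left) (simp add: o_def)
      then have "(\<lambda>n. inverse \<epsilon> * inner (p (s n)) h) \<longlonglongrightarrow> 0" by simp
      then show "(\<lambda>n. inner (x n) h) \<longlonglongrightarrow> 0"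
      proof (rule Lim_null_comparison[OF _ tendsto_rabs_zero, rotated])
        have "\<bar>inner (x n) h\<bar> \<le> \<bar>inverse \<epsilon> * inner (p (s n)) h\<bar>" for n
        proof -
          have "\<bar>c n\<bar> \<le> \<bar>inverse \<epsilon>\<bar>" using s(2)[of n] \<epsilon> by (simp add: c_def le_imp_inverse_le)
          then show ?thesis by (simp add: x_def abs_mult mult_right_mono)
        qed
        then show "\<forall>\<^sub>F n in sequentially. norm (inner (x n) h) \<le> \<bar>inverse \<epsilon> * inner (p (s n)) h\<bar>" by simp
      qed
    qed
    then have "Inf {liminf (\<lambda>n. ereal (mu2 J A L (x n))) | x.
        (\<forall>n. x n \<in> DL - {0} \<and> norm (x n) = 1) \<and> weak_to_zero x} \<le> liminf (\<lambda>n. ereal (mu2 J A L (x n)))"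
      using x0 xDL x1 by (intro Inf_lower) blast
    also have "\<dots> \<le> liminf (\<lambda>n. ereal (lam (s n)))"
    proof (intro Liminf_mono always_eventually allI)
      fix n
      \<comment> \<open>Scaling keeps the eigenvalue, so \<open>mu2\<close> of the normalised vector
        is still bounded by \<open>lam (s n)\<close>.\<close>
      have "eigpair (V (s n)) (lam (s n)) (x n) (c n *\<^sub>R q (s n))"
        unfolding x_def by (rule eigpair_scale[OF sV V(2) e])
      then show "ereal (mu2 J A L (x n)) \<le> ereal (lam (s n))"
        using mu2_le_eigenvalue[OF V(1,2) _ lam(2) x0] by simp
    qed
    also have "\<dots> = ereal l"
    proof (rule lim_imp_Liminf)
      show "(\<lambda>n. ereal (lam (s n))) \<longlonglongrightarrow> ereal l"
        using LIMSEQ_subseq_LIMSEQ[OF lam(1) s(1)] by (simp add: o_def)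
    qed simp
    finally show False using l(2) by simp
  qed
  \<comment> \<open>The eigenvalues dominate \<open>mu2\<close> and tend to \<open>l < b\<close>, so
    \<open>strong\<close> becomes applicable.\<close>
  have "limsup (\<lambda>n. ereal (mu2 J A L (p n))) \<le> limsup (\<lambda>n. ereal (lam n))"
    using mu2_le_eigenvalue[OF V(1,2) e lam(2) p0] by (intro Limsup_mono always_eventually) simp
  also have "\<dots> = ereal l" using lam(1) by (intro lim_imp_Limsup) auto
  finally have "limsup (\<lambda>n. ereal (mu2 J A L (p n))) < b" using b by simp
  then have Ap: "(\<lambda>n. inner (A (p n)) (p n)) \<longlonglongrightarrow> 0" using strong[of p] p_lim p0 pq by simp
  have np: "(\<lambda>n. (norm (p n))\<^sup>2) \<longlonglongrightarrow> 0" using tendsto_power[OF tendsto_norm_zero[OF p_lim], of 2] by simp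
  \<comment> \<open>By Pythagoras \<open>L (q n)\<close> carries all the norm in the limit, so the
    form inequality for eigenpairs tends to \<open>0 \<le> d - l\<close>.\<close>
  have Lq: "(norm (L (q n)))\<^sup>2 = 1 - (norm (p n))\<^sup>2" for n using norm_PL_sum[OF pq, of n n] nrm[of n] by simp
  have "(\<lambda>n. inner (A (p n)) (p n) - lam n * (norm (p n))\<^sup>2) \<longlonglongrightarrow> 0 - l * 0"
    by (intro tendsto_intros Ap lam np)
  moreover have "(\<lambda>n. (d - lam n) * (1 - (norm (p n))\<^sup>2)) \<longlonglongrightarrow> (d - l) * (1 - 0)"
    by (intro tendsto_intros lam np)
  moreover have "inner (A (p n)) (p n) - lam n * (norm (p n))\<^sup>2 \<le> (d - lam n) * (1 - (norm (p n))\<^sup>2)" for n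
    using eigpair_form_left[OF sV V(2) e, of n] by (simp add: Lq)
  ultimately have "0 - l * 0 \<le> (d - l) * (1 - 0)" by (intro LIMSEQ_le) auto
  then show False using l(1) by simp
qed

end

section \<open>From the spectral hypotheses to the form bound\<close>

theorem mainTheorem13:
  fixes J :: "'h::{real_inner,complete_space} \<Rightarrow> 'h"
    and A :: "'h \<Rightarrow> 'h" and DA :: "'h set"
    and P :: "'h \<Rightarrow> 'h"
    and L :: "'h \<Rightarrow> 'h" and DL :: "'h set"
    and d :: real
  assumes J: "cstruct J"
    and separable: "\<exists>S. countable S \<and> closure S = (UNIV :: 'h set)"
    and A_sa: "self_adjoint_in J UNIV DA A"
    and P_proj: "bounded_linear P" "\<forall>x. P (P x) = P x" "\<forall>x y. inner (P x) y = inner x (P y)"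
       "\<forall>x. P (J x) = J (P x)"
    and L_lin: "clinear_on J DL L"
    and DL_sub: "DL \<subseteq> range P"
    and L_range: "\<forall>x\<in>DL. L x \<in> range (\<lambda>y. y - P y)"
    and L_inj: "inj_on L DL"
    and core: "dsum DL L \<subseteq> DA" "is_core DA A (dsum DL L)"
    and PAP_esa: "ess_self_adjoint_in J (range P) DL (\<lambda>x. P (A x))"
    and QAQ_esa: "ess_self_adjoint_in J (range (\<lambda>y. y - P y)) (L ` DL) (\<lambda>x. A x - P (A x))"
    and d_def: "d = Sup (spec_in (range (\<lambda>y. y - P y))
                     (gclos_dom (L ` DL) (\<lambda>x. A x - P (A x))) (gclos (L ` DL) (\<lambda>x. A x - P (A x))))"
    and d_bdd: "bdd_above (spec_in (range (\<lambda>y. y - P y))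
                     (gclos_dom (L ` DL) (\<lambda>x. A x - P (A x))) (gclos (L ` DL) (\<lambda>x. A x - P (A x))))"
    and d_ne: "spec_in (range (\<lambda>y. y - P y))
                     (gclos_dom (L ` DL) (\<lambda>x. A x - P (A x))) (gclos (L ` DL) (\<lambda>x. A x - P (A x))) \<noteq> {}"
  shows
   "(let m2'' = Inf ((\<lambda>x. ereal (mu2 J A L x)) ` (DL - {0})) in
      ereal d < m2'' \<longrightarrow> Spu J DA A DL L \<inter> {l. d < l \<and> ereal l < m2''} = {})
    \<and>
    (let m2' = Inf {liminf (\<lambda>n. ereal (mu2 J A L (x n))) | x.
                     (\<forall>n. x n \<in> DL - {0} \<and> norm (x n) = 1) \<and> weak_to_zero x} in
      \<forall>b::ereal. ereal d < m2' \<longrightarrow> ereal d < b \<longrightarrow>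
        (\<forall>x. (\<forall>n. x n \<in> DL - {0}) \<longrightarrow> x \<longlonglongrightarrow> 0 \<longrightarrow>
             limsup (\<lambda>n. ereal (mu2 J A L (x n))) < b \<longrightarrow>
             (\<lambda>n. inner (A (x n)) (x n)) \<longlonglongrightarrow> 0) \<longrightarrow>
        Spu J DA A DL L \<inter> {l. d < l \<and> ereal l < min m2' b} = {})"
proof -
  let ?K = "range (\<lambda>y. y - P y)" and ?S = "L ` DL" and ?T = "\<lambda>x. A x - P (A x)"
  interpret P: bounded_linear P by (rule P_proj(1))
  have Q: "bounded_linear (\<lambda>y. y - P y)"
    by (intro bounded_linear_sub bounded_linear_ident P_proj(1))
  have A_clin: "clinear_on J DA A" and A_sym: "\<And>x y. x \<in> DA \<Longrightarrow> y \<in> DA \<Longrightarrow> inner (A x) y = inner x (A y)"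
    and DA_dense: "closure DA = UNIV"
    using A_sa unfolding self_adjoint_in_def by auto
  have A_lin: "\<And>x y. x \<in> DA \<Longrightarrow> y \<in> DA \<Longrightarrow> A (x + y) = A x + A y"
      "\<And>x c. x \<in> DA \<Longrightarrow> A (c *\<^sub>R x) = c *\<^sub>R A x" and sDA: "subspace DA"
    using A_clin unfolding clinear_on_def csubspace_def by blast+
  have L_add: "\<And>x y. x \<in> DL \<Longrightarrow> y \<in> DL \<Longrightarrow> L (x + y) = L x + L y"
      and L_scale: "\<And>x c. x \<in> DL \<Longrightarrow> L (c *\<^sub>R x) = c *\<^sub>R L x" and sDL: "subspace DL"
    using L_lin unfolding clinear_on_def csubspace_def by blast+
  have P_DL: "P x = x" if "x \<in> DL" for x
    using that DL_sub P_proj(2) by (metis imageE subsetD)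
  have P_L: "P (L x) = 0" if "x \<in> DL" for x
    using that L_range P_proj(2) by (force simp: P.diff)
  have LDA: "L x \<in> DA" if "x \<in> DL" for x
  proof -
    have "0 + L x \<in> dsum DL L" unfolding dsum_def using that subspace_0[OF sDL] by blast
    then show ?thesis using core(1) by auto
  qed
  have L0: "L 0 = 0" using L_scale[of 0 0] subspace_0[OF sDL] by simp
  have S: "subspace ?S"
  proof (rule subspaceI)
    show "0 \<in> ?S" using L0 subspace_0[OF sDL] by force
    show "x + y \<in> ?S" if "x \<in> ?S" "y \<in> ?S" for x y
      using that L_add subspace_add[OF sDL] by (metis (no_types, lifting) image_iff)
    show "c *\<^sub>R x \<in> ?S" if "x \<in> ?S" for x c
      using that L_scale subspace_scale[OF sDL] by (metis (no_types, lifting) image_iff)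
  qed
  have spec_le: "m \<le> d" if "m \<in> spec_in ?K (gclos_dom ?S ?T) (gclos ?S ?T)" for m
    unfolding d_def by (rule cSup_upper[OF that d_bdd])
  \<comment> \<open>The closure agrees with \<open>A - P A\<close> on \<open>L DL\<close>, so the
    spectral bound holds for the form there; the \<open>P A\<close> part drops out because
    \<open>L x\<close> is orthogonal to the range of \<open>P\<close>.\<close>
  have form_le: "inner (A (L x)) (L x) \<le> d * (norm (L x))\<^sup>2" if x: "x \<in> DL" for x
  proof -
    have diff: "?T (y - L x) = ?T y - ?T (L x)" if "y \<in> ?S" for y
    proof -
      have "y \<in> DA" "(-1) *\<^sub>R L x \<in> DA"
        using that LDA x subspace_scale[OF sDA] by blast+
      then have "A (y + (-1) *\<^sub>R L x) = A y - A (L x)"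
        using A_lin(1)[of y "(-1) *\<^sub>R L x"] A_lin(2)[OF LDA[OF x], of "-1"] by simp
      then show ?thesis by (simp add: P.diff)
    qed
    have clos: "closable ?S ?T" and sa: "self_adjoint_in J ?K (gclos_dom ?S ?T) (gclos ?S ?T)"
      using QAQ_esa unfolding ess_self_adjoint_in_def by auto
    have g: "L x \<in> gclos_dom ?S ?T" "gclos ?S ?T (L x) = ?T (L x)"
      using gclos_extends[OF clos S imageI[OF x] diff] by blast+
    have "inner (gclos ?S ?T (L x)) (L x) \<le> d * (norm (L x))\<^sup>2"
      by (rule self_adjoint_form_le_Sup_spec[OF sa Q _ _ refl spec_le g(1)])
        (use P_proj in \<open>auto simp: P.diff inner_diff_left inner_diff_right\<close>)
    moreover have "inner (P (A (L x))) (L x) = 0" using P_proj(3) P_L[OF x] by simp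
    ultimately show ?thesis by (simp add: g(2) inner_diff_left)
  qed
  interpret pl_operator J A DA P L DL d
    by unfold_locales (use J A_clin A_sym P_proj L_lin P_DL P_L core(1) form_le in auto)
  \<comment> \<open>On the zero space every \<open>T - m\<close> is bijective, so the spectrum would
    be empty, against \<open>d_ne\<close>. The nonzero vector guarantees nonempty compressed
    spectra.\<close>
  have "\<exists>x0\<in>DA. x0 \<noteq> 0"
  proof (rule ccontr)
    assume "\<not> ?thesis"
    then have "DA \<subseteq> {0}" by auto
    then have "closure DA \<subseteq> {0}" by (metis closure_minimal closed_singleton)
    then have zero: "x = 0" for x :: 'h using DA_dense by auto
    obtain m where m: "m \<in> spec_in ?K (gclos_dom ?S ?T) (gclos ?S ?T)" using d_ne by blast
    have "0 \<in> gclos_dom ?S ?T"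
    proof -
      have "\<forall>n::nat. (\<lambda>_. 0) n \<in> ?S" using subspace_0[OF S] by simp
      then show ?thesis unfolding gclos_dom_def
        by (intro CollectI exI[of _ "\<lambda>_. 0"]) (auto intro: convergent_const)
    qed
    then have "gclos_dom ?S ?T = {0}" "?K = {0}" using zero by auto
    then have "bij_betw (\<lambda>x. gclos ?S ?T x - m *\<^sub>R x) (gclos_dom ?S ?T) ?K"
      using zero by (auto simp: bij_betw_def)
    moreover have "norm x \<le> 0 * norm (gclos ?S ?T x - m *\<^sub>R x)" for x
      using zero[of x] by simp
    ultimately show False using m unfolding spec_in_def by blast
  qed
  then obtain x0 where x0: "x0 \<in> DA" "x0 \<noteq> 0" by blast
  show ?thesis
    unfolding Let_def
  proof (intro conjI allI impI)
    show "Spu J DA A DL L \<inter> {l. d < l \<and> ereal l < Inf ((\<lambda>x. ereal (mu2 J A L x)) ` (DL - {0}))} = {}"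
      using no_spurious_below_Inf_mu2[OF x0] by blast
  next
    fix b
    let ?m = "Inf {liminf (\<lambda>n. ereal (mu2 J A L (x n))) | x.
                     (\<forall>n. x n \<in> DL - {0} \<and> norm (x n) = 1) \<and> weak_to_zero x}"
    assume strong: "\<forall>x. (\<forall>n. x n \<in> DL - {0}) \<longrightarrow> x \<longlonglongrightarrow> 0 \<longrightarrow>
             limsup (\<lambda>n. ereal (mu2 J A L (x n))) < b \<longrightarrow>
             (\<lambda>n. inner (A (x n)) (x n)) \<longlonglongrightarrow> 0"
    have "l \<notin> Spu J DA A DL L" if l: "d < l" "ereal l < min ?m b" for l
    proof -
      from l(2) have "ereal l < ?m" "ereal l < b" by simp_all
      then show ?thesis
        by (rule no_spurious_below_weak_mu2[OF x0 l(1)]) (use strong in blast)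
    qed
    then show "Spu J DA A DL L \<inter> {l. d < l \<and> ereal l < min ?m b} = {}" by blast
  qed
qed

end
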